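(* Let $\mu\in Q^\vee$, $\kappa\in\mathbb C^\times$, and let $g(\lambda)$, $\lambda\in\mathfrak h^*$, be a function with values in $V$ satisfying the differential equation $d_\mu g(\lambda)=D_\mu(\lambda)g(\lambda)$, where $$D_\mu(\lambda)=\frac1{2\kappa}\Big(-2T(h_\mu)_1+\sum_{i=1}^n\omega_i^\vee(h_\mu)t_i^2+\sum_{\alpha\in\mathbf R_+}\frac{\langle\alpha,\mu\rangle}{e^{-\langle\lambda,\alpha\rangle}-1}2x_\alpha^-x_\alpha^+\Big)\in Y_1\mathfrak g.$$ Then $$\tilde g(\lambda)=g(-\lambda)\cdot\prod_{\alpha\in\mathbf R_+}\big(e^{-\langle\lambda,\alpha\rangle}-1\big)^{-\frac1{2\kappa}t_\alpha}$$ (the product being the operator $\prod_\alpha(\cdots)^{-t_\alpha/2\kappa}$ applied to the vector $g(-\lambda)$) satisfies the trigonometric Casimir equation with $b=-2\kappa$, namely $$d_\mu\tilde g(\lambda)=\frac1{-2\kappa}\Big(-2T(h_\mu)_1+\sum_{i=1}^n\omega_i^\vee(h_\mu)t_i^2+\sum_{\alpha\in\mathbf R_+}\frac{\langle\alpha,\mu\rangle}{e^{\langle\lambda,\alpha\rangle}-1}K_\alpha\Big)\tilde g(\lambda).$$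
   Context: $\mathfrak g$ is a simple complex Lie algebra of rank $n$, $\mathfrak h$ a Cartan subalgebra, $\alpha_1,\dots,\alpha_n$ simple roots, $\mathbf R_+$ positive roots, $e_i,f_i,h_i$ Chevalley generators, $a_{ij}=\alpha_j(h_i)$, $d_i$ the minimal positive integers with $d_ia_{ij}=d_ja_{ji}$; $\langle\cdot,\cdot\rangle$ is the invariant form with $\langle h_i,h_j\rangle=d_i^{-1}a_{ji}$, $\langle e_i,f_j\rangle=\delta_{ij}d_i^{-1}$, used to identify $\mathfrak h\cong\mathfrak h^*$ (so $\langle\alpha_i,\alpha_j\rangle=d_ia_{ij}$). $\alpha^\vee=2\alpha/\langle\alpha,\alpha\rangle$; $Q^\vee=\sum_i\mathbb Z\alpha_i^\vee\subset\mathfrak h^*$; $\omega_i^\vee\in\mathfrak h^*$ are the fundamental coweights, $\langle\omega_i^\vee,\alpha_j\rangle=\delta_{ij}$; $h_\mu\in\mathfrak h$ corresponds to $\mu\in Q^\vee$ and $t_\alpha\in\mathfrak h$ corresponds to $\alpha$; $t_i=t_{\alpha_i}$. For $\alpha\in\mathbf R_+$, $x_\alpha^\pm$ are root vectors for $\pm\alpha$ with $\langle x_\alpha^+,x_\alpha^-\rangle=1$, and $K_\alpha=x_\alpha^+x_\alpha^-+x_\alpha^-x_\alpha^+$; $x_i^\pm=x_{\alpha_i}^\pm$. $Y_1\mathfrak g$ is the Yangian at $\hbar=1$: the $\mathbb C$-algebra generated by $X_{i,r}^\pm,T_{i,r}$ ($1\le i\le n$, $r\ge0$) with relations $[T_{i,r},T_{j,s}]=0$;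 $[T_{i,0},X_{j,s}^\pm]=\pm d_ia_{ij}X_{j,s}^\pm$; $[X_{i,r}^+,X_{j,s}^-]=\delta_{ij}T_{i,r+s}$; $[T_{i,r+1},X_{j,s}^\pm]-[T_{i,r},X_{j,s+1}^\pm]=\pm\frac12d_ia_{ij}(T_{i,r}X_{j,s}^\pm+X_{j,s}^\pm T_{i,r})$; $[X_{i,r+1}^\pm,X_{j,s}^\pm]-[X_{i,r}^\pm,X_{j,s+1}^\pm]=\pm\frac12d_ia_{ij}(X_{i,r}^\pm X_{j,s}^\pm+X_{j,s}^\pm X_{i,r}^\pm)$; and $\sum_\sigma\mathrm{ad}X^\pm_{i,r_{\sigma(1)}}\cdots\mathrm{ad}X^\pm_{i,r_{\sigma(1-a_{ij})}}X_{j,s}^\pm=0$ for $i\ne j$. $U\mathfrak g$ embeds via $t_i\mapsto T_{i,0}$, $x_i^\pm\mapsto X_{i,0}^\pm$. $h\mapsto T(h)_1$ is the linear map $\mathfrak h\to Y_1\mathfrak g$ with $T(t_i)_1=T_{i,1}$. $V$ is the representation of $Y_1\mathfrak g$ on the (completed) tensor product of the loop representations associated with finite-dimensional representations $V_1,\dots,V_N$ of $Y_1\mathfrak g$; the claim involves $V$ only as a $Y_1\mathfrak g$-module with a weight decomposition under $\mathfrak h$. $d_\mu$ is the derivative in direction $\mu$; $\lambda$ ranges over points where $e^{\langle\lambda,\alpha\rangle}\neq1$ for all $\alpha\in\mathbf R_+$, and for a commuting family the power $y^{A}$ means $\exp(A\log y)$ for a local branch of $\log$. For $b\in\mathbb C^\times$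 the trigonometric Casimir equation is $$d_\mu\varphi(\lambda)=\frac1b\Big(\sum_{\alpha\in\mathbf R_+}\frac{\langle\alpha,\mu\rangle}{e^{\langle\alpha,\lambda\rangle}-1}K_\alpha-2T(h_\mu)_1+\sum_i\langle\omega_i^\vee,\mu\rangle t_i^2\Big)\varphi(\lambda).$$ *)

theory Defs
  imports
    "HOL-Analysis.Analysis"
    "HOL-Library.Poly_Mapping"
    "HOL-Combinatorics.Permutations"
begin

section \<open>Simple complex Lie algebras\<close>

record 'g lie_algebra =
  lscale :: "complex \<Rightarrow> 'g \<Rightarrow> 'g"
  lbr :: "'g \<Rightarrow> 'g \<Rightarrow> 'g"

locale complex_lie_algebra =
  fixes G :: "('g::ab_group_add, 'm) lie_algebra_scheme"
  assumes vector_space_lscale: "vector_space (lscale G)"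
    and lbr_linear_left: "\<And>y. Vector_Spaces.linear (lscale G) (lscale G) (\<lambda>x. lbr G x y)"
    and lbr_linear_right: "\<And>x. Vector_Spaces.linear (lscale G) (lscale G) (lbr G x)"
    and lbr_self: "\<And>x. lbr G x x = 0"
    and jacobi: "\<And>x y z. lbr G x (lbr G y z) + lbr G y (lbr G z x) + lbr G z (lbr G x y) = 0"

definition lie_ideal :: "('g::ab_group_add, 'm) lie_algebra_scheme \<Rightarrow> 'g set \<Rightarrow> bool" where
  "lie_ideal G I \<longleftrightarrow> module.subspace (lscale G) I \<and> (\<forall>x. \<forall>y\<in>I. lbr G x y \<in> I)"

locale simple_complex_lie_algebra = complex_lie_algebra G
  for G :: "('g::ab_group_add, 'm) lie_algebra_scheme" +
  assumes finite_dim: "\<exists>B. finite B \<and> module.span (lscale G) B = UNIV"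
    and not_abelian: "\<exists>x y. lbr G x y \<noteq> 0"
    and simple: "\<And>I. lie_ideal G I \<Longrightarrow> I = {0} \<or> I = UNIV"

primrec lower_central :: "('g::ab_group_add, 'm) lie_algebra_scheme \<Rightarrow> 'g set \<Rightarrow> nat \<Rightarrow> 'g set" where
  "lower_central G H 0 = H"
| "lower_central G H (Suc k) =
     module.span (lscale G) {lbr G x y | x y. x \<in> H \<and> y \<in> lower_central G H k}"

definition cartan_subalgebra :: "('g::ab_group_add, 'm) lie_algebra_scheme \<Rightarrow> 'g set \<Rightarrow> bool" where
  "cartan_subalgebra G H \<longleftrightarrow>
     module.subspace (lscale G) H \<and> (\<forall>x\<in>H. \<forall>y\<in>H. lbr G x y \<in> H) \<and>
     (\<exists>k. lower_central G H k = {0}) \<and>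
     (\<forall>x. (\<forall>y\<in>H. lbr G x y \<in> H) \<longrightarrow> x \<in> H)"


section \<open>Roots, Chevalley generators, invariant form\<close>

text \<open>The finite type \<open>'i\<close> indexes the simple roots; its cardinality is the rank.\<close>

record ('g, 'i) chevalley_datum = "'g lie_algebra" +
  cartan :: "'g set"
  sroot :: "'i \<Rightarrow> 'g \<Rightarrow> complex"
  che :: "'i \<Rightarrow> 'g"
  chf :: "'i \<Rightarrow> 'g"
  cmat :: "'i \<Rightarrow> 'i \<Rightarrow> int"
  csym :: "'i \<Rightarrow> nat"
  form :: "'g \<Rightarrow> 'g \<Rightarrow> complex"
  coweight :: "'i \<Rightarrow> 'g \<Rightarrow> complex"
  xplus :: "('g \<Rightarrow> complex) \<Rightarrow> 'g"
  xminus :: "('g \<Rightarrow> complex) \<Rightarrow> 'g"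

definition chh :: "('g, 'i) chevalley_datum \<Rightarrow> 'i \<Rightarrow> 'g" where
  "chh G i = lbr G (che G i) (chf G i)"

text \<open>Linear functionals on the Cartan subalgebra are extended by zero to the whole Lie algebra,
  so that they are determined by their restriction.\<close>

definition hstar :: "('g::ab_group_add, 'i) chevalley_datum \<Rightarrow> ('g \<Rightarrow> complex) set" where
  "hstar G = {l. (\<forall>x\<in>cartan G. \<forall>y\<in>cartan G. l (x + y) = l x + l y) \<and>
                 (\<forall>c. \<forall>x\<in>cartan G. l (lscale G c x) = c * l x) \<and>
                 (\<forall>x. x \<notin> cartan G \<longrightarrow> l x = 0)}"

definition root_space :: "('g, 'i) chevalley_datum \<Rightarrow> ('g \<Rightarrow> complex) \<Rightarrow> 'g set" where
  "root_space G a = {x. \<forall>t\<in>cartan G. lbr G t x = lscale G (a t) x}"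

definition roots :: "('g::ab_group_add, 'i) chevalley_datum \<Rightarrow> ('g \<Rightarrow> complex) set" where
  "roots G = {a \<in> hstar G. a \<noteq> (\<lambda>_. 0) \<and> root_space G a \<noteq> {0}}"

definition pos_roots :: "('g::ab_group_add, 'i::finite) chevalley_datum \<Rightarrow> ('g \<Rightarrow> complex) set" where
  "pos_roots G = {a \<in> roots G. \<exists>k::'i \<Rightarrow> nat. a = (\<lambda>x. \<Sum>i\<in>UNIV. of_nat (k i) * sroot G i x)}"

text \<open>The isomorphism from the dual of the Cartan subalgebra to the Cartan subalgebra given by the
  form: \<open>hvec G \<mu>\<close> is $h_\mu$, and \<open>hvec G \<alpha>\<close> is $t_\alpha$ for a root $\alpha$.\<close>

definition hvec :: "('g, 'i) chevalley_datum \<Rightarrow> ('g \<Rightarrow> complex) \<Rightarrow> 'g" where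
  "hvec G l = (THE x. x \<in> cartan G \<and> (\<forall>y\<in>cartan G. form G x y = l y))"

definition pairing :: "('g, 'i) chevalley_datum \<Rightarrow> ('g \<Rightarrow> complex) \<Rightarrow> ('g \<Rightarrow> complex) \<Rightarrow> complex" where
  "pairing G l m = form G (hvec G l) (hvec G m)"

definition coroot :: "('g, 'i) chevalley_datum \<Rightarrow> ('g \<Rightarrow> complex) \<Rightarrow> 'g \<Rightarrow> complex" where
  "coroot G a = (\<lambda>x. 2 * a x / pairing G a a)"

definition coroot_lattice :: "('g, 'i::finite) chevalley_datum \<Rightarrow> ('g \<Rightarrow> complex) set" where
  "coroot_lattice G =
     {m. \<exists>k::'i \<Rightarrow> int. m = (\<lambda>x. \<Sum>i\<in>UNIV. of_int (k i) * coroot G (sroot G i) x)}"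

definition symmetrizes :: "('i \<Rightarrow> nat) \<Rightarrow> ('i \<Rightarrow> 'i \<Rightarrow> int) \<Rightarrow> bool" where
  "symmetrizes d a \<longleftrightarrow> (\<forall>i. 0 < d i) \<and> (\<forall>i j. int (d i) * a i j = int (d j) * a j i)"

locale simple_chevalley_datum = simple_complex_lie_algebra G
  for G :: "('g::ab_group_add, 'i::finite) chevalley_datum" +
  assumes cartan: "cartan_subalgebra G (cartan G)"
    \<comment> \<open>simple roots\<close>
    and sroot_root: "\<And>i. sroot G i \<in> roots G"
    and sroot_indep: "\<And>c. \<lbrakk>\<And>x. (\<Sum>i\<in>UNIV. c i * sroot G i x) = 0\<rbrakk> \<Longrightarrow> c = (\<lambda>_. 0)"
    and sroot_span: "\<And>l. l \<in> hstar G \<Longrightarrow> \<exists>c. l = (\<lambda>x. \<Sum>i\<in>UNIV. c i * sroot G i x)"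
    and root_sign: "\<And>a. a \<in> roots G \<Longrightarrow> a \<in> pos_roots G \<or> - a \<in> pos_roots G"
    \<comment> \<open>Chevalley generators and Cartan matrix\<close>
    and che: "\<And>i. che G i \<in> root_space G (sroot G i)"
    and chf: "\<And>i. chf G i \<in> root_space G (- sroot G i)"
    and sroot_chh: "\<And>i. sroot G i (chh G i) = 2"
    and cmat: "\<And>i j. of_int (cmat G i j) = sroot G j (chh G i)"
    and csym: "symmetrizes (csym G) (cmat G)"
    and csym_minimal: "\<And>d i. symmetrizes d (cmat G) \<Longrightarrow> csym G i \<le> d i"
    \<comment> \<open>invariant form\<close>
    and form_linear: "\<And>x. Vector_Spaces.linear (lscale G) (*) (form G x)"
    and form_sym: "\<And>x y. form G x y = form G y x"
    and form_invariant: "\<And>x y z. form G (lbr G x y) z = form G x (lbr G y z)"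
    and form_chh: "\<And>i j. form G (chh G i) (chh G j) = of_int (cmat G j i) / of_nat (csym G i)"
    and form_che_chf: "\<And>i j. form G (che G i) (chf G j) = (if i = j then 1 / of_nat (csym G i) else 0)"
    \<comment> \<open>fundamental coweights and root vectors\<close>
    and coweight_hstar: "\<And>i. coweight G i \<in> hstar G"
    and coweight_dual: "\<And>i j. pairing G (coweight G i) (sroot G j) = (if i = j then 1 else 0)"
    and xplus: "\<And>a. a \<in> pos_roots G \<Longrightarrow> xplus G a \<in> root_space G a"
    and xminus: "\<And>a. a \<in> pos_roots G \<Longrightarrow> xminus G a \<in> root_space G (- a)"
    and form_xplus_xminus: "\<And>a. a \<in> pos_roots G \<Longrightarrow> form G (xplus G a) (xminus G a) = 1"


section \<open>Free associative algebras\<close>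

datatype 'x word = Word (letters: "'x list")

instantiation word :: (type) monoid_add
begin
definition "0 = Word []"
definition "v + w = Word (letters v @ letters w)"
instance
  by standard (simp_all add: zero_word_def plus_word_def)
end

text \<open>Finitely supported complex functions on words, with the convolution product.\<close>

type_synonym 'x free_algebra = "'x word \<Rightarrow>\<^sub>0 complex"

definition gen :: "'x \<Rightarrow> 'x free_algebra" where
  "gen x = Poly_Mapping.single (Word [x]) 1"

definition const :: "complex \<Rightarrow> 'x free_algebra" where
  "const c = Poly_Mapping.single 0 c"

definition free_eval :: "(complex \<Rightarrow> 'y \<Rightarrow> 'y) \<Rightarrow> ('x \<Rightarrow> 'y::ring_1) \<Rightarrow> 'x free_algebra \<Rightarrow> 'y" where
  "free_eval s g p =
     (\<Sum>w\<in>Poly_Mapping.keys p. s (Poly_Mapping.lookup p w) (prod_list (map g (letters w))))"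

inductive_set generated_ideal :: "'r::ring_1 set \<Rightarrow> 'r set" for R where
  zero: "0 \<in> generated_ideal R"
| base: "r \<in> R \<Longrightarrow> r \<in> generated_ideal R"
| add: "p \<in> generated_ideal R \<Longrightarrow> q \<in> generated_ideal R \<Longrightarrow> p + q \<in> generated_ideal R"
| left: "p \<in> generated_ideal R \<Longrightarrow> q * p \<in> generated_ideal R"
| right: "p \<in> generated_ideal R \<Longrightarrow> p * q \<in> generated_ideal R"

definition commutator :: "'r::ring \<Rightarrow> 'r \<Rightarrow> 'r" where
  "commutator a b = a * b - b * a"

locale complex_algebra =
  fixes s :: "complex \<Rightarrow> 'y::ring_1 \<Rightarrow> 'y"
  assumes vector_space: "vector_space s"
    and scale_mult_left: "\<And>c a b. s c a * b = s c (a * b)"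
    and scale_mult_right: "\<And>c a b. a * s c b = s c (a * b)"


section \<open>The Yangian at parameter 1\<close>

datatype sign = Plus | Minus

definition sgn_val :: "sign \<Rightarrow> complex" where
  "sgn_val p = (case p of Plus \<Rightarrow> 1 | Minus \<Rightarrow> - 1)"

datatype 'i yangian_gen = XG sign 'i nat | TG 'i nat

abbreviation fX :: "sign \<Rightarrow> 'i \<Rightarrow> nat \<Rightarrow> 'i yangian_gen free_algebra" where
  "fX p i r \<equiv> gen (XG p i r)"

abbreviation fT :: "'i \<Rightarrow> nat \<Rightarrow> 'i yangian_gen free_algebra" where
  "fT i r \<equiv> gen (TG i r)"

inductive_set yangian_relators ::
  "('i \<Rightarrow> 'i \<Rightarrow> int) \<Rightarrow> ('i \<Rightarrow> nat) \<Rightarrow> 'i yangian_gen free_algebra set" for a d where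
  TT: "commutator (fT i r) (fT j s) \<in> yangian_relators a d"
| T0X: "commutator (fT i 0) (fX p j s) - const (sgn_val p * of_nat (d i) * of_int (a i j)) * fX p j s
      \<in> yangian_relators a d"
| XX: "commutator (fX Plus i r) (fX Minus j s) - (if i = j then fT i (r + s) else 0)
      \<in> yangian_relators a d"
| TX: "commutator (fT i (Suc r)) (fX p j s) - commutator (fT i r) (fX p j (Suc s))
       - const (sgn_val p / 2 * of_nat (d i) * of_int (a i j)) * (fT i r * fX p j s + fX p j s * fT i r)
      \<in> yangian_relators a d"
| XXX: "commutator (fX p i (Suc r)) (fX p j s) - commutator (fX p i r) (fX p j (Suc s))
       - const (sgn_val p / 2 * of_nat (d i) * of_int (a i j)) * (fX p i r * fX p j s + fX p j s * fX p i r)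
      \<in> yangian_relators a d"
| serre: "i \<noteq> j \<Longrightarrow>
      (\<Sum>\<sigma> | \<sigma> permutes {..<nat (1 - a i j)}.
         foldr (\<lambda>k z. commutator (fX p i (r (\<sigma> k))) z) [0..<nat (1 - a i j)] (fX p j s))
      \<in> yangian_relators a d"

record ('i, 'y) yangian =
  yscale :: "complex \<Rightarrow> 'y \<Rightarrow> 'y"
  yX :: "sign \<Rightarrow> 'i \<Rightarrow> nat \<Rightarrow> 'y"
  yT :: "'i \<Rightarrow> nat \<Rightarrow> 'y"

definition yangian_val :: "('i, 'y) yangian \<Rightarrow> 'i yangian_gen \<Rightarrow> 'y" where
  "yangian_val Y g = (case g of XG p i r \<Rightarrow> yX Y p i r | TG i r \<Rightarrow> yT Y i r)"

text \<open>An algebra is presented by the generators and relators if evaluation of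
  noncommutative polynomials induces an isomorphism from the free algebra modulo the two-sided
  ideal generated by the relators.\<close>

locale is_yangian = complex_algebra "yscale Y"
  for a :: "'i \<Rightarrow> 'i \<Rightarrow> int" and d :: "'i \<Rightarrow> nat" and Y :: "('i, 'y::ring_1) yangian" +
  assumes generated: "surj (free_eval (yscale Y) (yangian_val Y))"
    and presented: "{p. free_eval (yscale Y) (yangian_val Y) p = 0} =
                      generated_ideal (yangian_relators a d)"

text \<open>The Lie algebra is generated by \<open>t\<^sub>i\<close> and the simple root vectors, so \<open>\<iota>\<close> is uniquely
  determined; products of values of \<open>\<iota>\<close> are the images of the corresponding products in the
  enveloping algebra.\<close>

definition yangian_embedding ::
  "('g::ab_group_add, 'i) chevalley_datum \<Rightarrow> ('i, 'y::ring_1) yangian \<Rightarrow> ('g \<Rightarrow> 'y) \<Rightarrow> bool" where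
  "yangian_embedding G Y \<iota> \<longleftrightarrow>
     Vector_Spaces.linear (lscale G) (yscale Y) \<iota> \<and>
     (\<forall>x y. \<iota> (lbr G x y) = commutator (\<iota> x) (\<iota> y)) \<and>
     (\<forall>i. \<iota> (hvec G (sroot G i)) = yT Y i 0) \<and>
     (\<forall>i. \<iota> (xplus G (sroot G i)) = yX Y Plus i 0) \<and>
     (\<forall>i. \<iota> (xminus G (sroot G i)) = yX Y Minus i 0)"

text \<open>The linear map $h \mapsto T(h)_1$; only its values on the Cartan subalgebra matter.\<close>

definition is_T1 ::
  "('g::ab_group_add, 'i) chevalley_datum \<Rightarrow> ('i, 'y::ring_1) yangian \<Rightarrow> ('g \<Rightarrow> 'y) \<Rightarrow> bool" where
  "is_T1 G Y T1 \<longleftrightarrow>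
     (\<forall>x\<in>cartan G. \<forall>y\<in>cartan G. T1 (x + y) = T1 x + T1 y) \<and>
     (\<forall>c. \<forall>x\<in>cartan G. T1 (lscale G c x) = yscale Y c (T1 x)) \<and>
     (\<forall>i. T1 (hvec G (sroot G i)) = yT Y i 1)"


section \<open>Modules with a weight decomposition\<close>

locale complex_tvs =
  fixes s :: "complex \<Rightarrow> 'v::{topological_ab_group_add, t2_space} \<Rightarrow> 'v"
  assumes vector_space: "vector_space s"
    and continuous_scale: "continuous_on UNIV (\<lambda>(c, v). s c v)"

locale algebra_module =
  fixes s :: "complex \<Rightarrow> 'y::ring_1 \<Rightarrow> 'y" and vs :: "complex \<Rightarrow> 'v::ab_group_add \<Rightarrow> 'v"
    and \<rho> :: "'y \<Rightarrow> 'v \<Rightarrow> 'v"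
  assumes linear: "\<And>a. Vector_Spaces.linear vs vs (\<rho> a)"
    and act_add: "\<And>a b v. \<rho> (a + b) v = \<rho> a v + \<rho> b v"
    and act_scale: "\<And>c a v. \<rho> (s c a) v = vs c (\<rho> a v)"
    and act_mult: "\<And>a b v. \<rho> (a * b) v = \<rho> a (\<rho> b v)"
    and act_one: "\<And>v. \<rho> 1 v = v"

definition weight_space ::
  "('g, 'i) chevalley_datum \<Rightarrow> ('g \<Rightarrow> 'y) \<Rightarrow> (complex \<Rightarrow> 'v \<Rightarrow> 'v) \<Rightarrow> ('y \<Rightarrow> 'v \<Rightarrow> 'v) \<Rightarrow>
   ('g \<Rightarrow> complex) \<Rightarrow> 'v set" where
  "weight_space G \<iota> vs \<rho> \<nu> = {v. \<forall>t\<in>cartan G. \<rho> (\<iota> t) v = vs (\<nu> t) v}"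

text \<open>The module is the direct sum of its weight spaces, with projections \<open>P \<nu>\<close>, and carries the
  topology induced from the product of the weight spaces. The latter is automatic in the case of
  finitely many weights, see \<open>finite_weight_decomposition\<close> below.\<close>

definition weight_decomposition ::
  "('g::ab_group_add, 'i) chevalley_datum \<Rightarrow> ('g \<Rightarrow> 'y) \<Rightarrow>
   (complex \<Rightarrow> 'v::{topological_ab_group_add, t2_space} \<Rightarrow> 'v) \<Rightarrow> ('y \<Rightarrow> 'v \<Rightarrow> 'v) \<Rightarrow> bool" where
  "weight_decomposition G \<iota> vs \<rho> \<longleftrightarrow>
     (\<exists>P. (\<forall>\<nu>\<in>hstar G. \<forall>v. P \<nu> v \<in> weight_space G \<iota> vs \<rho> \<nu>) \<and>
          (\<forall>v. finite {\<nu>\<in>hstar G. P \<nu> v \<noteq> 0} \<and> v = (\<Sum>\<nu> | \<nu> \<in> hstar G \<and> P \<nu> v \<noteq> 0. P \<nu> v)) \<and>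
          (\<forall>v. nhds v = (INF \<nu>\<in>hstar G. filtercomap (P \<nu>) (nhds (P \<nu> v)))))"

lemma finite_weight_decomposition:
  fixes G :: "('g::ab_group_add, 'i) chevalley_datum"
    and vs :: "complex \<Rightarrow> 'v::{topological_ab_group_add, t2_space} \<Rightarrow> 'v"
    and \<rho> :: "'y \<Rightarrow> 'v \<Rightarrow> 'v"
  assumes tvs: "complex_tvs vs"
    and lin: "\<And>t. t \<in> cartan G \<Longrightarrow> Vector_Spaces.linear vs vs (\<rho> (\<iota> t))"
    and cont: "\<And>t. t \<in> cartan G \<Longrightarrow> continuous_on UNIV (\<rho> (\<iota> t))"
    and fin: "finite {\<nu>\<in>hstar G. weight_space G \<iota> vs \<rho> \<nu> \<noteq> {0}}"
    and span: "module.span vs (\<Union>\<nu>\<in>hstar G. weight_space G \<iota> vs \<rho> \<nu>) = UNIV"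
  shows "weight_decomposition G \<iota> vs \<rho>"
proof -
  interpret vector_space vs using tvs by (rule complex_tvs.vector_space)
  interpret vp: vector_space_pair vs vs by unfold_locales
  let ?V = "weight_space G \<iota> vs \<rho>"
  define W where "W = {\<nu>\<in>hstar G. ?V \<nu> \<noteq> {0}}"
  have cont_scale: "continuous_on UNIV (\<lambda>v. vs c (f v))" if "continuous_on UNIV f" for c and f :: "'v \<Rightarrow> 'v"
  proof -
    have "continuous_on UNIV (\<lambda>v. (c, f v))" by (intro continuous_intros that)
    from continuous_on_compose2[OF complex_tvs.continuous_scale[OF tvs] this]
    show ?thesis by simp
  qed
  have VD: "\<rho> (\<iota> t) v = vs (\<nu> t) v" if "v \<in> ?V \<nu>" "t \<in> cartan G" for v \<nu> t
    using that by (simp add: weight_space_def)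
  have sub: "subspace (?V \<nu>)" for \<nu>
  proof -
    have z: "\<rho> (\<iota> t) 0 = 0" and a: "\<rho> (\<iota> t) (x + y) = \<rho> (\<iota> t) x + \<rho> (\<iota> t) y"
      and m: "\<rho> (\<iota> t) (vs c x) = vs c (\<rho> (\<iota> t) x)" if "t \<in> cartan G" for t x y c
      using lin[OF that] by (simp_all add: vp.linear_0 vp.linear_add vp.linear_scale)
    show ?thesis
      by (auto simp: subspace_def weight_space_def z a m scale_right_distrib mult.commute)
  qed
  let ?sep = "\<lambda>\<nu> S Q. Vector_Spaces.linear vs vs Q \<and> continuous_on UNIV Q \<and> (\<forall>v\<in>?V \<nu>. Q v = v) \<and>
        (\<forall>\<sigma>\<in>S. \<forall>v\<in>?V \<sigma>. Q v = 0) \<and> (\<forall>\<sigma>. \<forall>v\<in>?V \<sigma>. \<exists>c. Q v = vs c v)"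
  have sep: "\<exists>Q. ?sep \<nu> S Q" if "finite S" "S \<subseteq> hstar G" "\<nu> \<in> hstar G" "\<nu> \<notin> S" for \<nu> S
    using that
  proof (induction S rule: finite_induct)
    case empty
    have *: "?sep \<nu> {} (\<lambda>v. v)"
    proof (intro conjI allI ballI)
      show "Vector_Spaces.linear vs vs (\<lambda>v. v)" by (rule linear_ident)
      show "\<exists>c. v = vs c v" for v :: 'v by (rule exI[of _ 1]) simp
    qed (simp_all add: continuous_on_id)
    show ?case by (rule exI[where x = "\<lambda>v. v"]) (rule *)
  next
    case (insert \<sigma> S)
    have "\<exists>Q. ?sep \<nu> S Q"
      by (rule insert.IH) (use insert.prems in auto)
    then obtain Q where Q: "?sep \<nu> S Q" by (rule exE)
    note Q1 = conjunct1[OF Q] and Q2 = conjunct1[OF conjunct2[OF Q]]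
      and Q3 = bspec[OF conjunct1[OF conjunct2[OF conjunct2[OF Q]]]]
      and Q4 = bspec[OF bspec[OF conjunct1[OF conjunct2[OF conjunct2[OF conjunct2[OF Q]]]]]]
      and Q5 = bspec[OF spec[OF conjunct2[OF conjunct2[OF conjunct2[OF conjunct2[OF Q]]]]]]
    have \<sigma>: "\<sigma> \<in> hstar G" and \<nu>: "\<nu> \<in> hstar G" and "\<nu> \<noteq> \<sigma>" using insert.prems by auto
    have "\<exists>t\<in>cartan G. \<nu> t \<noteq> \<sigma> t"
    proof (rule ccontr)
      assume "\<not> ?thesis"
      moreover have "\<nu> t = 0 \<and> \<sigma> t = 0" if "t \<notin> cartan G" for t
        using \<sigma> \<nu> that unfolding hstar_def by simp
      ultimately have "\<nu> t = \<sigma> t" for t by metis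
      then show False using \<open>\<nu> \<noteq> \<sigma>\<close> by blast
    qed
    then obtain t where t: "t \<in> cartan G" "\<nu> t \<noteq> \<sigma> t" by blast
    interpret l: Vector_Spaces.linear vs vs "\<rho> (\<iota> t)" using lin[OF t(1)] .
    interpret q: Vector_Spaces.linear vs vs Q using Q1 .
    define R where "R v = vs (1 / (\<nu> t - \<sigma> t)) (\<rho> (\<iota> t) (Q v) - vs (\<sigma> t) (Q v))" for v
    have Rc: "R v = vs ((\<tau> t - \<sigma> t) / (\<nu> t - \<sigma> t) * c) v"
      if "v \<in> ?V \<tau>" "Q v = vs c v" for v \<tau> c
    proof -
      have "\<rho> (\<iota> t) (Q v) = vs (\<tau> t * c) v" using that VD[OF that(1) t(1)]
        by (simp add: l.scale mult.commute)
      then have "\<rho> (\<iota> t) (Q v) - vs (\<sigma> t) (Q v) = vs ((\<tau> t - \<sigma> t) * c) v"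
        using that by (simp add: left_diff_distrib flip: scale_left_diff_distrib)
      then show ?thesis by (simp add: R_def)
    qed
    have "Vector_Spaces.linear vs vs R"
    proof unfold_locales
      show "R (x + y) = R x + R y" for x y
        unfolding R_def l.add q.add scale_right_distrib scale_right_diff_distrib by simp
      show "R (vs c x) = vs c (R x)" for c x
        unfolding R_def l.scale q.scale scale_right_diff_distrib scale_scale
        by (simp add: mult_ac)
    qed
    moreover have "continuous_on UNIV R"
    proof -
      have "continuous_on UNIV (\<lambda>v. \<rho> (\<iota> t) (Q v))"
        using continuous_on_compose2[OF cont[OF t(1)] Q2] by simp
      then show ?thesis unfolding R_def
        by (intro cont_scale continuous_intros) (assumption | rule Q2)+
    qed
    moreover have "\<forall>\<tau>. \<forall>v\<in>?V \<tau>. \<exists>c. R v = vs c v"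
    proof (intro allI ballI)
      fix \<tau> v assume v: "v \<in> ?V \<tau>"
      obtain c where "Q v = vs c v" using Q5[OF v] by (rule exE)
      from Rc[OF v this] show "\<exists>c. R v = vs c v" by (intro exI)
    qed
    moreover have "\<forall>v\<in>?V \<nu>. R v = v"
    proof
      fix v assume v: "v \<in> ?V \<nu>"
      then have "Q v = vs 1 v" using Q3 by simp
      from Rc[OF v this] show "R v = v" using t by simp
    qed
    moreover have "\<forall>\<tau>\<in>insert \<sigma> S. \<forall>v\<in>?V \<tau>. R v = 0"
    proof (intro ballI)
      fix \<tau> v assume \<tau>: "\<tau> \<in> insert \<sigma> S" and v: "v \<in> ?V \<tau>"
      show "R v = 0"
      proof (cases "\<tau> = \<sigma>")
        case True
        obtain c where "Q v = vs c v" using Q5[OF v] by (rule exE)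
        from Rc[OF v this] show ?thesis using True by simp
      next
        case False
        then have "Q v = vs 0 v" using Q4[of \<tau> v] \<tau> v by simp
        from Rc[OF v this] show ?thesis by simp
      qed
    qed
    ultimately have *: "?sep \<nu> (insert \<sigma> S) R" by (intro conjI)
    show ?case by (rule exI[where x = R]) (rule *)
  qed
  have "\<exists>Q. ?sep \<nu> (W - {\<nu>}) Q" if "\<nu> \<in> W" for \<nu>
    by (rule sep) (use that fin in \<open>auto simp: W_def\<close>)
  note someI = someI_ex[OF this]
  define P0 where "P0 \<nu> = (SOME Q. ?sep \<nu> (W - {\<nu>}) Q)" for \<nu>
  have P0: "?sep \<nu> (W - {\<nu>}) (P0 \<nu>)" if "\<nu> \<in> W" for \<nu>
    unfolding P0_def using that by (rule someI)
  define P where "P \<nu> = (if \<nu> \<in> W then P0 \<nu> else (\<lambda>_. 0))" for \<nu>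
  have Plin: "Vector_Spaces.linear vs vs (P \<nu>)" for \<nu>
    using conjunct1[OF P0[of \<nu>]] vp.linear_zero by (cases "\<nu> \<in> W") (simp_all add: P_def)
  have Pcont: "continuous_on UNIV (P \<nu>)" for \<nu>
    using conjunct1[OF conjunct2[OF P0[of \<nu>]]] by (cases "\<nu> \<in> W") (simp_all add: P_def)
  have Pval: "P \<nu> v = (if \<nu> = \<sigma> then v else 0)" if "v \<in> ?V \<sigma>" "\<sigma> \<in> hstar G" for \<nu> \<sigma> v
  proof (cases "\<sigma> \<in> W")
    case True
    show ?thesis
    proof (cases "\<nu> \<in> W")
      case \<nu>: True
      note Q = P0[OF \<nu>]
      show ?thesis
      proof (cases "\<nu> = \<sigma>")
        case True
        then show ?thesis
          using bspec[OF conjunct1[OF conjunct2[OF conjunct2[OF Q]]]] \<nu> that by (simp add: P_def)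
      next
        case False
        then have "\<sigma> \<in> W - {\<nu>}" using \<open>\<sigma> \<in> W\<close> by simp
        from bspec[OF bspec[OF conjunct1[OF conjunct2[OF conjunct2[OF conjunct2[OF Q]]]] this] that(1)]
        show ?thesis using \<nu> False by (simp add: P_def)
      qed
    next
      case False
      then show ?thesis using True by (auto simp: P_def)
    qed
  next
    case False
    then have "v = 0" using that by (auto simp: W_def)
    then show ?thesis using vp.linear_0[OF Plin] by simp
  qed
  have "P \<nu> v \<in> ?V \<nu>" if "\<nu> \<in> hstar G" for \<nu> v
  proof -
    have "v \<in> span (\<Union>\<nu>\<in>hstar G. ?V \<nu>)" using span by simp
    then show ?thesis
    proof (induction rule: span_induct_alt)
      case base
      then show ?case using vp.linear_0[OF Plin] subspace_0[OF sub] by simp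
    next
      case (step c x y)
      then obtain \<sigma> where "\<sigma> \<in> hstar G" "x \<in> ?V \<sigma>" by blast
      then have "P \<nu> x \<in> ?V \<nu>" using Pval subspace_0[OF sub] by auto
      then show ?case using step
        by (simp add: vp.linear_add[OF Plin] vp.linear_scale[OF Plin] subspace_add[OF sub] subspace_scale[OF sub])
    qed
  qed
  moreover have total: "v = (\<Sum>\<nu>\<in>W. P \<nu> v)" for v
  proof -
    have "v \<in> span (\<Union>\<nu>\<in>hstar G. ?V \<nu>)" using span by simp
    then show ?thesis
    proof (induction rule: span_induct_alt)
      case base
      then show ?case using vp.linear_0[OF Plin] by simp
    next
      case (step c x y)
      then obtain \<sigma> where \<sigma>: "\<sigma> \<in> hstar G" "x \<in> ?V \<sigma>" by blast
      have "finite W" using fin by (simp add: W_def)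
      then have "(\<Sum>\<nu>\<in>W. P \<nu> x) = (if \<sigma> \<in> W then x else 0)"
        using Pval[OF \<sigma>(2,1)] by simp
      also have "\<dots> = x" using \<sigma> by (auto simp: W_def)
      finally show ?case using step
        by (simp add: vp.linear_add[OF Plin] vp.linear_scale[OF Plin] sum.distrib flip: scale_sum_right)
    qed
  qed
  have finW: "finite W" using fin by (simp add: W_def)
  have supp: "{\<nu>\<in>hstar G. P \<nu> v \<noteq> 0} \<subseteq> W" for v by (auto simp: P_def split: if_splits)
  moreover have "finite {\<nu>\<in>hstar G. P \<nu> v \<noteq> 0}" for v
    using supp finW by (rule finite_subset)
  moreover have "v = (\<Sum>\<nu> | \<nu> \<in> hstar G \<and> P \<nu> v \<noteq> 0. P \<nu> v)" for v
  proof -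
    have "(\<Sum>\<nu> | \<nu> \<in> hstar G \<and> P \<nu> v \<noteq> 0. P \<nu> v) = (\<Sum>\<nu>\<in>W. P \<nu> v)"
      using supp finW by (intro sum.mono_neutral_left) (auto simp: W_def)
    then show ?thesis using total by simp
  qed
  moreover have "nhds v = (INF \<nu>\<in>hstar G. filtercomap (P \<nu>) (nhds (P \<nu> v)))" (is "_ = ?F") for v
  proof (rule antisym)
    have "(P \<nu> \<longlongrightarrow> P \<nu> v) (nhds v)" for \<nu>
      using Pcont[of \<nu>] tendsto_at_iff_tendsto_nhds[of "P \<nu>" v]
      by (simp add: continuous_on_eq_continuous_at isCont_def)
    then show "nhds v \<le> ?F"
      by (auto intro!: INF_greatest simp: filterlim_iff_le_filtercomap[symmetric])
    have "(P \<nu> \<longlongrightarrow> P \<nu> v) ?F" if "\<nu> \<in> W" for \<nu>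
      using that unfolding filterlim_iff_le_filtercomap by (auto intro: INF_lower simp: W_def)
    then have "((\<lambda>w. \<Sum>\<nu>\<in>W. P \<nu> w) \<longlongrightarrow> (\<Sum>\<nu>\<in>W. P \<nu> v)) ?F" by (intro tendsto_sum)
    then have "((\<lambda>w. w) \<longlongrightarrow> v) ?F" using total by simp
    then show "?F \<le> nhds v" by (simp add: filterlim_def)
  qed
  ultimately show ?thesis unfolding weight_decomposition_def by blast
qed


section \<open>Differential equations\<close>

text \<open>The dual of the Cartan subalgebra carries the topology of pointwise convergence, which is its
  usual topology as a finite-dimensional space. The direction parameter \<open>z\<close> is complex, i.e.
  derivatives are holomorphic.\<close>

definition has_dir_derivative ::
  "(complex \<Rightarrow> 'v::{topological_ab_group_add, t2_space} \<Rightarrow> 'v) \<Rightarrow> ('g \<Rightarrow> complex) \<Rightarrow>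
   (('g \<Rightarrow> complex) \<Rightarrow> 'v) \<Rightarrow> 'v \<Rightarrow> ('g \<Rightarrow> complex) \<Rightarrow> bool" where
  "has_dir_derivative vs \<mu> g v l \<longleftrightarrow>
     ((\<lambda>z::complex. vs (1 / z) (g (\<lambda>x. l x + z * \<mu> x) - g l)) \<longlongrightarrow> v) (at 0)"

definition solves_on ::
  "(complex \<Rightarrow> 'v::{topological_ab_group_add, t2_space} \<Rightarrow> 'v) \<Rightarrow> ('y \<Rightarrow> 'v \<Rightarrow> 'v) \<Rightarrow>
   ('g \<Rightarrow> complex) \<Rightarrow> (('g \<Rightarrow> complex) \<Rightarrow> 'y) \<Rightarrow> (('g \<Rightarrow> complex) \<Rightarrow> 'v) \<Rightarrow>
   ('g \<Rightarrow> complex) set \<Rightarrow> bool" where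
  "solves_on vs \<rho> \<mu> A g W \<longleftrightarrow> (\<forall>l\<in>W. has_dir_derivative vs \<mu> g (\<rho> (A l) (g l)) l)"

definition regular_points :: "('g::ab_group_add, 'i::finite) chevalley_datum \<Rightarrow> ('g \<Rightarrow> complex) set" where
  "regular_points G = {l \<in> hstar G. \<forall>a\<in>pos_roots G. exp (pairing G l a) \<noteq> 1}"

definition D_op ::
  "('g::ab_group_add, 'i::finite) chevalley_datum \<Rightarrow> ('i, 'y::ring_1) yangian \<Rightarrow> ('g \<Rightarrow> 'y) \<Rightarrow> ('g \<Rightarrow> 'y) \<Rightarrow>
   complex \<Rightarrow> ('g \<Rightarrow> complex) \<Rightarrow> ('g \<Rightarrow> complex) \<Rightarrow> 'y" where
  "D_op G Y \<iota> T1 \<kappa> \<mu> l = yscale Y (1 / (2 * \<kappa>))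
     (yscale Y (- 2) (T1 (hvec G \<mu>))
      + (\<Sum>i\<in>UNIV. yscale Y (coweight G i (hvec G \<mu>)) ((\<iota> (hvec G (sroot G i)))\<^sup>2))
      + (\<Sum>a\<in>pos_roots G. yscale Y (pairing G a \<mu> / (exp (- pairing G l a) - 1))
           (yscale Y 2 (\<iota> (xminus G a) * \<iota> (xplus G a)))))"

definition casimir_K :: "('g, 'i) chevalley_datum \<Rightarrow> ('g \<Rightarrow> 'y::ring_1) \<Rightarrow> ('g \<Rightarrow> complex) \<Rightarrow> 'y" where
  "casimir_K G \<iota> a = \<iota> (xplus G a) * \<iota> (xminus G a) + \<iota> (xminus G a) * \<iota> (xplus G a)"

definition trig_casimir ::
  "('g::ab_group_add, 'i::finite) chevalley_datum \<Rightarrow> ('i, 'y::ring_1) yangian \<Rightarrow> ('g \<Rightarrow> 'y) \<Rightarrow> ('g \<Rightarrow> 'y) \<Rightarrow>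
   complex \<Rightarrow> ('g \<Rightarrow> complex) \<Rightarrow> ('g \<Rightarrow> complex) \<Rightarrow> 'y" where
  "trig_casimir G Y \<iota> T1 b \<mu> l = yscale Y (1 / b)
     ((\<Sum>a\<in>pos_roots G. yscale Y (pairing G a \<mu> / (exp (pairing G a l) - 1)) (casimir_K G \<iota> a))
      - yscale Y 2 (T1 (hvec G \<mu>))
      + (\<Sum>i\<in>UNIV. yscale Y (pairing G (coweight G i) \<mu>) ((\<iota> (hvec G (sroot G i)))\<^sup>2)))"

definition op_exp ::
  "(complex \<Rightarrow> 'v::{topological_ab_group_add, t2_space} \<Rightarrow> 'v) \<Rightarrow> ('v \<Rightarrow> 'v) \<Rightarrow> 'v \<Rightarrow> 'v" where
  "op_exp vs A v = suminf (\<lambda>k. vs (1 / fact k) ((A ^^ k) v))"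

text \<open>For a branch \<open>L\<close> of the logarithm of \<open>y\<close>, the power $y^A$ is \<open>op_exp vs (\<lambda>v. vs L (A v))\<close>.\<close>

definition log_branch_on :: "'b::topological_space set \<Rightarrow> ('b \<Rightarrow> complex) \<Rightarrow> ('b \<Rightarrow> complex) \<Rightarrow> bool" where
  "log_branch_on U y L \<longleftrightarrow> continuous_on U L \<and> (\<forall>l\<in>U. exp (L l) = y l)"

text \<open>The composition of commuting operators over the positive roots is a fold, which does not
  depend on the order.\<close>

definition gauge_transform ::
  "('g::ab_group_add, 'i::finite) chevalley_datum \<Rightarrow> ('i, 'y::ring_1) yangian \<Rightarrow> ('g \<Rightarrow> 'y) \<Rightarrow>
   (complex \<Rightarrow> 'v::{topological_ab_group_add, t2_space} \<Rightarrow> 'v) \<Rightarrow> ('y \<Rightarrow> 'v \<Rightarrow> 'v) \<Rightarrow> complex \<Rightarrow>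
   (('g \<Rightarrow> complex) \<Rightarrow> ('g \<Rightarrow> complex) \<Rightarrow> complex) \<Rightarrow>
   (('g \<Rightarrow> complex) \<Rightarrow> 'v) \<Rightarrow> ('g \<Rightarrow> complex) \<Rightarrow> 'v" where
  "gauge_transform G Y \<iota> vs \<rho> \<kappa> L g l =
     Finite_Set.fold
       (\<lambda>a. op_exp vs (\<lambda>v. vs (L a l) (\<rho> (yscale Y (- 1 / (2 * \<kappa>)) (\<iota> (hvec G a))) v)))
       (g (- l)) (pos_roots G)"

end

theory Submission
  imports Defs
begin

text \<open>Every term of \<open>D_op\<close> commutes with the Cartan subalgebra, so the equation splits into equations
  for the weight components of \<open>g\<close>. On the component of weight \<open>\<nu>\<close> the gauge factor is the scalar
  $\exp(-\frac1{2\kappa}\sum_\alpha L_\alpha(\lambda)\,\nu(t_\alpha))$, and the product rule adds to $-D_\mu(-\lambda)$ its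
  logarithmic derivative
  $-\frac1{2\kappa}\sum_\alpha\frac{\langle\alpha,\mu\rangle}{e^{\langle\alpha,\lambda\rangle}-1}\nu(t_\alpha)$.
  Since $[x_\alpha^+,x_\alpha^-]=t_\alpha$, this is exactly what turns $2x_\alpha^-x_\alpha^+$ into $K_\alpha$.\<close>

section \<open>Graded topological vector spaces\<close>

context complex_tvs
begin

sublocale vector_space s
  by (rule vector_space)

lemma tendsto_scale:
  assumes "(f \<longlongrightarrow> c) F" and "(u \<longlongrightarrow> v) F"
  shows "((\<lambda>x. s (f x) (u x)) \<longlongrightarrow> s c v) F"
proof -
  have "isCont (\<lambda>(c, v). s c v) (c, v)"
    using continuous_scale by (simp add: continuous_on_eq_continuous_at)
  from isCont_tendsto_compose[OF this tendsto_Pair[OF assms]]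
  show ?thesis by simp
qed

text \<open>Product rule for a scalar function times a vector-valued one. The increment is split
  with \<open>e\<close> taken at \<open>z\<close> and \<open>u\<close> at 0, so the continuity it
  calls for is that of \<open>e\<close>, which differentiability supplies.\<close>

lemma tendsto_difference_quotient_scale:
  fixes e :: "complex \<Rightarrow> complex"
  assumes e: "(e has_field_derivative e') (at 0)"
    and u: "((\<lambda>z. s (1 / z) (u z - u 0)) \<longlongrightarrow> u') (at 0)"
  shows "((\<lambda>z. s (1 / z) (s (e z) (u z) - s (e 0) (u 0))) \<longlongrightarrow> s (e 0) u' + s e' (u 0)) (at 0)"
proof -
  have "(e \<longlongrightarrow> e 0) (at 0)"
    using DERIV_isCont[OF e] by (simp add: isCont_def)
  moreover have "((\<lambda>z. (e z - e 0) / z) \<longlongrightarrow> e') (at 0)"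
    using e by (simp add: has_field_derivative_iff)
  ultimately have "((\<lambda>z. s (e z) (s (1 / z) (u z - u 0)) + s ((e z - e 0) / z) (u 0))
      \<longlongrightarrow> s (e 0) u' + s e' (u 0)) (at 0)"
    by (intro tendsto_add tendsto_scale u tendsto_const)
  \<comment> \<open>At \<open>z = 0\<close> both sides vanish because \<open>1 / 0 = 0\<close>, so
    the identity needs no side condition.\<close>
  moreover have "s (e z) (s (1 / z) (u z - u 0)) + s ((e z - e 0) / z) (u 0)
      = s (1 / z) (s (e z) (u z) - s (e 0) (u 0))" for z
    by (simp add: scale_right_diff_distrib scale_left_diff_distrib diff_divide_distrib)
  ultimately show ?thesis by simp
qed

end

text \<open>Abstract form of a weight decomposition, with linearity and orthogonality of the
  projections made explicit. The last assumption says that the topology is the one induced by the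
  components. Analytic claims thus reduce to a single component, where the operators of interest are
  scalars.\<close>

locale graded_tvs = complex_tvs s
  for s :: "complex \<Rightarrow> 'v::{topological_ab_group_add, t2_space} \<Rightarrow> 'v" +
  fixes W :: "'w set" and P :: "'w \<Rightarrow> 'v \<Rightarrow> 'v"
  assumes P_linear: "\<And>\<nu>. \<nu> \<in> W \<Longrightarrow> Vector_Spaces.linear s s (P \<nu>)"
    and P_P: "\<And>\<nu> \<sigma> v. \<nu> \<in> W \<Longrightarrow> \<sigma> \<in> W \<Longrightarrow> P \<nu> (P \<sigma> v) = (if \<nu> = \<sigma> then P \<sigma> v else 0)"
    and finite_support: "\<And>v. finite {\<nu>\<in>W. P \<nu> v \<noteq> 0}"
    and sum_P: "\<And>v. (\<Sum>\<nu> | \<nu> \<in> W \<and> P \<nu> v \<noteq> 0. P \<nu> v) = v"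
    and nhds_P: "\<And>v. nhds v = (INF \<nu>\<in>W. filtercomap (P \<nu>) (nhds (P \<nu> v)))"
begin

lemma P_diff: "\<nu> \<in> W \<Longrightarrow> P \<nu> (v - w) = P \<nu> v - P \<nu> w"
  and P_scale: "\<nu> \<in> W \<Longrightarrow> P \<nu> (s c v) = s c (P \<nu> v)"
  and P_sum: "\<nu> \<in> W \<Longrightarrow> P \<nu> (\<Sum>i\<in>I. f i) = (\<Sum>i\<in>I. P \<nu> (f i))"
proof -
  interpret vp: vector_space_pair s s by unfold_locales
  show "\<nu> \<in> W \<Longrightarrow> P \<nu> (v - w) = P \<nu> v - P \<nu> w"
    "\<nu> \<in> W \<Longrightarrow> P \<nu> (s c v) = s c (P \<nu> v)"
    "\<nu> \<in> W \<Longrightarrow> P \<nu> (\<Sum>i\<in>I. f i) = (\<Sum>i\<in>I. P \<nu> (f i))"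
    by (simp_all add: P_linear vp.linear_diff vp.linear_scale vp.linear_sum)
qed

lemma P_eqI:
  assumes "\<And>\<nu>. \<nu> \<in> W \<Longrightarrow> P \<nu> v = P \<nu> w"
  shows "v = w"
proof -
  have "(\<Sum>\<nu> | \<nu> \<in> W \<and> P \<nu> v \<noteq> 0. P \<nu> v) = (\<Sum>\<nu> | \<nu> \<in> W \<and> P \<nu> w \<noteq> 0. P \<nu> w)"
    using assms by (intro sum.cong) auto
  then show ?thesis by (simp only: sum_P)
qed

lemma tendsto_iff_P: "(f \<longlongrightarrow> v) F \<longleftrightarrow> (\<forall>\<nu>\<in>W. ((\<lambda>x. P \<nu> (f x)) \<longlongrightarrow> P \<nu> v) F)"
  unfolding nhds_P[of v] filterlim_INF filterlim_filtercomap_iff o_def ..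

text \<open>A vector has finitely many nonzero components, so rescaling each of them by an arbitrary
  factor again gives a finite sum. This provides the limit of the exponential series as an actual
  vector.\<close>

lemma ex_scale_P: "\<exists>w. \<forall>\<nu>\<in>W. P \<nu> w = s (c \<nu>) (P \<nu> v)"
proof (intro exI ballI)
  fix \<nu> assume \<nu>: "\<nu> \<in> W"
  let ?S = "{\<sigma>\<in>W. P \<sigma> v \<noteq> 0}"
  have "P \<nu> (\<Sum>\<sigma>\<in>?S. s (c \<sigma>) (P \<sigma> v)) = (\<Sum>\<sigma>\<in>?S. if \<nu> = \<sigma> then s (c \<sigma>) (P \<sigma> v) else 0)"
    using \<nu> by (simp add: P_sum P_scale, intro sum.cong) (auto simp: P_P)
  also have "\<dots> = s (c \<nu>) (P \<nu> v)"
    using \<nu> finite_support by (simp add: sum.delta')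
  finally show "P \<nu> (\<Sum>\<sigma>\<in>?S. s (c \<sigma>) (P \<sigma> v)) = s (c \<nu>) (P \<nu> v)" .
qed

text \<open>On each component the partial sums are those of the scalar exponential series. Since
  convergence is componentwise, the operator series converges to the vector with the rescaled
  components, so \<open>suminf\<close> returns a genuine sum.\<close>

lemma P_op_exp:
  assumes A: "\<And>\<nu> v. \<nu> \<in> W \<Longrightarrow> P \<nu> (A v) = s (m \<nu>) (P \<nu> v)" and \<nu>: "\<nu> \<in> W"
  shows "P \<nu> (op_exp s A v) = s (exp (m \<nu>)) (P \<nu> v)"
proof -
  have pow: "P \<nu> ((A ^^ k) v) = s (m \<nu> ^ k) (P \<nu> v)" if "\<nu> \<in> W" for \<nu> k
    by (induction k) (simp_all add: A that)
  obtain w where w: "\<And>\<nu>. \<nu> \<in> W \<Longrightarrow> P \<nu> w = s (exp (m \<nu>)) (P \<nu> v)"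
    using ex_scale_P[of "\<lambda>\<nu>. exp (m \<nu>)" v] by blast
  have "(\<lambda>k. s (1 / fact k) ((A ^^ k) v)) sums w"
    unfolding sums_def
  proof (rule tendsto_iff_P[THEN iffD2], rule ballI)
    fix \<nu> assume \<nu>: "\<nu> \<in> W"
    have "(\<lambda>n. \<Sum>k<n. m \<nu> ^ k / fact k) \<longlonglongrightarrow> exp (m \<nu>)"
      using exp_converges[of "m \<nu>"]
      by (simp add: sums_def scaleR_conv_of_real divide_inverse_commute)
    then have "(\<lambda>n. s (\<Sum>k<n. m \<nu> ^ k / fact k) (P \<nu> v)) \<longlonglongrightarrow> P \<nu> w"
      unfolding w[OF \<nu>] by (intro tendsto_scale tendsto_const)
    moreover have "P \<nu> (\<Sum>k<n. s (1 / fact k) ((A ^^ k) v)) = s (\<Sum>k<n. m \<nu> ^ k / fact k) (P \<nu> v)" for n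
      by (simp add: P_sum P_scale pow \<nu> scale_sum_left)
    ultimately show "(\<lambda>n. P \<nu> (\<Sum>k<n. s (1 / fact k) ((A ^^ k) v))) \<longlonglongrightarrow> P \<nu> w" by simp
  qed
  then have "op_exp s A v = w" by (simp add: op_exp_def sums_iff)
  then show ?thesis using w \<nu> by simp
qed

text \<open>For infinite \<open>I\<close> both the fold and the sum are trivial.\<close>

lemma P_fold_op_exp:
  assumes A: "\<And>i \<nu> v. i \<in> I \<Longrightarrow> \<nu> \<in> W \<Longrightarrow> P \<nu> (A i v) = s (m i \<nu>) (P \<nu> v)" and \<nu>: "\<nu> \<in> W"
  shows "P \<nu> (Finite_Set.fold (\<lambda>i. op_exp s (A i)) v I) = s (exp (\<Sum>i\<in>I. m i \<nu>)) (P \<nu> v)"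
proof (cases "finite I")
  case False
  then show ?thesis by simp
next
  case True
  have E: "P \<nu> (op_exp s (A i) v) = s (exp (m i \<nu>)) (P \<nu> v)" if "i \<in> I" "\<nu> \<in> W" for i \<nu> v
    using A that by (intro P_op_exp) auto
  \<comment> \<open>Evaluating the fold requires commuting operators. The exponentials commute
    because they act by scalars on every component.\<close>
  interpret comp_fun_commute_on I "\<lambda>i. op_exp s (A i)"
  proof
    fix i j assume i: "i \<in> I" and j: "j \<in> I"
    show "op_exp s (A j) \<circ> op_exp s (A i) = op_exp s (A i) \<circ> op_exp s (A j)"
      by (rule ext, rule P_eqI) (simp add: E[OF i] E[OF j] mult.commute)
  qed
  have "P \<nu> (Finite_Set.fold (\<lambda>i. op_exp s (A i)) v J) = s (exp (\<Sum>i\<in>J. m i \<nu>)) (P \<nu> v)"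
    if "finite J" "J \<subseteq> I" for J
    using that
  proof (induction J rule: finite_induct)
    case (insert i J)
    then have "Finite_Set.fold (\<lambda>i. op_exp s (A i)) v (insert i J)
        = op_exp s (A i) (Finite_Set.fold (\<lambda>i. op_exp s (A i)) v J)"
      by (intro fold_insert) auto
    then show ?case using insert by (simp add: E \<nu> exp_add)
  qed simp
  then show ?thesis using True by simp
qed

end


section \<open>Duality on the Cartan subalgebra\<close>

context complex_lie_algebra
begin

sublocale vector_space "lscale G"
  by (rule vector_space_lscale)

sublocale vp: vector_space_pair "lscale G" "lscale G"
  by unfold_locales

lemmas lbr_scale_right = vp.linear_scale[OF lbr_linear_right]
  and lbr_minus_right = vp.linear_neg[OF lbr_linear_right]

lemma lbr_antisym: "lbr G x y = - lbr G y x"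
proof -
  have "lbr G x y + lbr G y x = lbr G (x + y) (x + y)"
    unfolding vp.linear_add[OF lbr_linear_left] vp.linear_add[OF lbr_linear_right]
    by (simp add: lbr_self)
  also have "\<dots> = 0" by (rule lbr_self)
  finally have "lbr G x y + lbr G y x = 0" .
  then show ?thesis by (simp add: eq_neg_iff_add_eq_0)
qed

end

lemma hstar_outside: "l \<in> hstar G \<Longrightarrow> x \<notin> cartan G \<Longrightarrow> l x = 0"
  by (simp add: hstar_def)

lemma hstar_add_mult:
  "l \<in> hstar G \<Longrightarrow> m \<in> hstar G \<Longrightarrow> (\<lambda>x. l x + c * m x) \<in> hstar G"
  by (auto simp: hstar_def algebra_simps)

lemma hstar_mult: "l \<in> hstar G \<Longrightarrow> (\<lambda>x. c * l x) \<in> hstar G"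
  by (auto simp: hstar_def algebra_simps)

lemma hstar_sum:
  "(\<And>i. i \<in> I \<Longrightarrow> l i \<in> hstar G) \<Longrightarrow> (\<lambda>x. \<Sum>i\<in>I. l i x) \<in> hstar G"
  by (auto simp: hstar_def sum.distrib sum_distrib_left)

section \<open>The invariant form on the Cartan subalgebra and its identification with the
  dual\<close>

context simple_chevalley_datum
begin

sublocale form: vector_space_pair "lscale G" "(*) :: complex \<Rightarrow> complex \<Rightarrow> complex"
  by unfold_locales (simp_all add: algebra_simps)

lemmas form_diff_right = form.linear_diff[OF form_linear]
  and form_scale_right = form.linear_scale[OF form_linear]
  and form_sum_right = form.linear_sum[OF form_linear]
  and form_add_right = form.linear_add[OF form_linear]

lemma cartan_subspace: "subspace (cartan G)"
  using cartan by (simp add: cartan_subalgebra_def)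

lemma cartan_normalizer: "(\<And>t. t \<in> cartan G \<Longrightarrow> lbr G x t \<in> cartan G) \<Longrightarrow> x \<in> cartan G"
  using cartan unfolding cartan_subalgebra_def by blast

lemma sroot_hstar: "sroot G i \<in> hstar G"
  using sroot_root by (simp add: roots_def)

lemma pos_root_hstar: "a \<in> pos_roots G \<Longrightarrow> a \<in> hstar G"
  by (simp add: pos_roots_def roots_def)

text \<open>By the Jacobi identity the contributions of \<open>a\<close> and \<open>- a\<close>
  cancel, so \<open>lbr G x y\<close> commutes with the Cartan subalgebra and lies in it, as that
  equals its own normalizer. Invariance of the form moves \<open>t\<close> onto \<open>y\<close>,
  where it acts by a scalar.\<close>

lemma lbr_opposite_root_spaces:
  assumes x: "x \<in> root_space G a" and y: "y \<in> root_space G (- a)"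
  shows "lbr G x y \<in> cartan G"
    and "\<And>t. t \<in> cartan G \<Longrightarrow> form G (lbr G x y) t = form G x y * a t"
proof -
  have x': "lbr G t x = lscale G (a t) x" and y': "lbr G t y = lscale G (- a t) y"
    if "t \<in> cartan G" for t
    using x y that by (simp_all add: root_space_def)
  show "lbr G x y \<in> cartan G"
  proof (rule cartan_normalizer)
    fix t assume t: "t \<in> cartan G"
    have "lbr G t (lbr G x y) = - (lbr G x (lbr G y t) + lbr G y (lbr G t x))"
      using jacobi[of t x y] by (subst eq_neg_iff_add_eq_0) (simp add: add.assoc)
    also have "\<dots> = 0"
      using t by (simp add: lbr_antisym[of y t] lbr_antisym[of y x] x' y' lbr_scale_right lbr_minus_right)
    finally show "lbr G (lbr G x y) t \<in> cartan G"
      using subspace_0[OF cartan_subspace] by (simp add: lbr_antisym[of "lbr G x y" t])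
  qed
  fix t assume t: "t \<in> cartan G"
  have "form G (lbr G x y) t = form G x (lbr G y t)" by (rule form_invariant)
  also have "lbr G y t = lscale G (a t) y"
    using t by (simp add: lbr_antisym[of y t] y')
  finally show "form G (lbr G x y) t = form G x y * a t"
    by (simp add: form_scale_right mult.commute)
qed

lemma chh_cartan: "chh G i \<in> cartan G"
  unfolding chh_def using che chf by (rule lbr_opposite_root_spaces)

text \<open>The normalization of the form on the pair \<open>che G i\<close>, \<open>chf G i\<close>
  contributes the factor \<open>1 / csym G i\<close>, which is cleared here.\<close>

lemma form_chh_sroot:
  assumes "t \<in> cartan G"
  shows "of_nat (csym G i) * form G (chh G i) t = sroot G i t"
proof -
  have "csym G i \<noteq> 0" using csym by (metis less_irrefl symmetrizes_def)
  then show ?thesis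
    unfolding chh_def using lbr_opposite_root_spaces(2)[OF che chf assms]
    by (simp add: form_che_chf)
qed

text \<open>A nonzero \<open>x\<close> is linearly independent, so some linear functional takes the
  value 1 there. It is cut off outside the Cartan subalgebra to fit the convention of
  \<open>hstar\<close>.\<close>

lemma hstar_separates:
  assumes x: "x \<in> cartan G" and l: "\<And>l. l \<in> hstar G \<Longrightarrow> l x = 0"
  shows "x = 0"
proof (rule ccontr)
  assume "x \<noteq> 0"
  then have "independent {x}" by simp
  then obtain f where f: "Vector_Spaces.linear (lscale G) ((*) :: complex \<Rightarrow> complex \<Rightarrow> complex) f" "f x = 1"
    using form.linear_independent_extend[of "{x}" "\<lambda>_. 1"] by auto
  have "(\<lambda>y. if y \<in> cartan G then f y else 0) \<in> hstar G"
    using subspace_add[OF cartan_subspace] subspace_scale[OF cartan_subspace]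
    by (auto simp: hstar_def form.linear_add[OF f(1)] form.linear_scale[OF f(1)])
  from l[OF this] show False using x f by simp
qed

text \<open>Simple roots span the dual, and each is a multiple of the form against
  \<open>chh G i\<close>. Orthogonality to these elements therefore kills every functional at
  \<open>x\<close>.\<close>

lemma form_nondegenerate_cartan:
  assumes x: "x \<in> cartan G" and 0: "\<And>t. t \<in> cartan G \<Longrightarrow> form G x t = 0"
  shows "x = 0"
proof (rule hstar_separates[OF x])
  fix l assume "l \<in> hstar G"
  then obtain c where l: "l = (\<lambda>y. \<Sum>i\<in>UNIV. c i * sroot G i y)" using sroot_span by blast
  have "sroot G i x = 0" for i
    using form_chh_sroot[OF x, of i] 0[OF chh_cartan, of i] by (simp add: form_sym)
  then show "l x = 0" by (simp add: l)
qed

text \<open>The element $d_ih_i$ represents the simple root $\alpha_i$, by invariance of the form.\<close>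

lemma hvec_ex1:
  assumes "l \<in> hstar G"
  shows "\<exists>!x. x \<in> cartan G \<and> (\<forall>t\<in>cartan G. form G x t = l t)"
proof (rule ex_ex1I)
  obtain c where l: "l = (\<lambda>y. \<Sum>i\<in>UNIV. c i * sroot G i y)" using sroot_span assms by blast
  let ?x = "\<Sum>i\<in>UNIV. lscale G (c i * of_nat (csym G i)) (chh G i)"
  have "?x \<in> cartan G"
    by (intro subspace_sum subspace_scale cartan_subspace chh_cartan)
  moreover have "form G ?x t = l t" if "t \<in> cartan G" for t
    unfolding form_sym[of ?x]
    by (simp add: form_sum_right form_scale_right l form_sym[of t] mult.assoc form_chh_sroot[OF that])
  ultimately show "\<exists>x. x \<in> cartan G \<and> (\<forall>t\<in>cartan G. form G x t = l t)" by blast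
next
  fix x y
  assume x: "x \<in> cartan G \<and> (\<forall>t\<in>cartan G. form G x t = l t)"
    and y: "y \<in> cartan G \<and> (\<forall>t\<in>cartan G. form G y t = l t)"
  have "x - y = 0"
    using x y by (intro form_nondegenerate_cartan subspace_diff cartan_subspace)
      (simp_all add: form_sym[of "x - y"] form_diff_right form_sym)
  then show "x = y" by simp
qed

lemma hvec_cartan: "l \<in> hstar G \<Longrightarrow> hvec G l \<in> cartan G"
  and form_hvec: "l \<in> hstar G \<Longrightarrow> t \<in> cartan G \<Longrightarrow> form G (hvec G l) t = l t"
  using theI'[OF hvec_ex1, of l] by (auto simp: hvec_def)

lemma hvec_eqI:
  "l \<in> hstar G \<Longrightarrow> x \<in> cartan G \<Longrightarrow> (\<And>t. t \<in> cartan G \<Longrightarrow> form G x t = l t) \<Longrightarrow> hvec G l = x"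
  using hvec_ex1[of l] hvec_cartan[of l] form_hvec[of l] by blast

lemma pairing_hvec:
  assumes "l \<in> hstar G" "m \<in> hstar G"
  shows "pairing G l m = l (hvec G m)"
  using assms by (simp add: pairing_def form_hvec hvec_cartan)

lemma pairing_sym: "pairing G l m = pairing G m l"
  by (simp add: pairing_def form_sym)

text \<open>The functional given by the form against \<open>t\<close> is a combination of simple
  roots, and \<open>hvec\<close> carries it back to \<open>t\<close>. This matters because
  \<open>\<iota>\<close> and \<open>T1\<close> are prescribed on the vectors of the simple
  roots.\<close>

lemma cartan_sum_hvec:
  assumes "t \<in> cartan G"
  shows "\<exists>c. t = (\<Sum>i\<in>UNIV. lscale G (c i) (hvec G (sroot G i)))"
proof -
  let ?l = "\<lambda>x. if x \<in> cartan G then form G t x else 0"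
  have "?l \<in> hstar G"
    using subspace_add[OF cartan_subspace] subspace_scale[OF cartan_subspace]
    by (auto simp: hstar_def form_add_right form_scale_right)
  then obtain c where c: "?l = (\<lambda>y. \<Sum>i\<in>UNIV. c i * sroot G i y)" using sroot_span by blast
  let ?t = "\<Sum>i\<in>UNIV. lscale G (c i) (hvec G (sroot G i))"
  have "hvec G ?l = t"
    using assms by (intro hvec_eqI \<open>?l \<in> hstar G\<close>) auto
  moreover have "hvec G ?l = ?t"
  proof (rule hvec_eqI[OF \<open>?l \<in> hstar G\<close>])
    show "?t \<in> cartan G"
      by (intro subspace_sum subspace_scale cartan_subspace hvec_cartan sroot_hstar)
    show "form G ?t y = ?l y" if "y \<in> cartan G" for y
      unfolding fun_cong[OF c, of y] form_sym[of ?t]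
      by (simp add: form_sum_right form_scale_right form_sym[of y] form_hvec sroot_hstar that)
  qed
  ultimately show ?thesis by auto
qed

text \<open>With the normalization \<open>form G (xplus G a) (xminus G a) = 1\<close>, the bracket
  pairs with each Cartan element \<open>t\<close> to \<open>a t\<close>, which characterizes
  \<open>hvec G a\<close>.\<close>

lemma lbr_xplus_xminus:
  assumes a: "a \<in> pos_roots G"
  shows "lbr G (xplus G a) (xminus G a) = hvec G a"
  using lbr_opposite_root_spaces[OF xplus[OF a] xminus[OF a]]
  by (intro hvec_eqI[symmetric] pos_root_hstar[OF a]) (simp_all add: form_xplus_xminus[OF a])

lemma coroot_lattice_hstar:
  assumes "m \<in> coroot_lattice G"
  shows "m \<in> hstar G"
proof -
  obtain k :: "'i \<Rightarrow> int" where
    "m = (\<lambda>x. \<Sum>i\<in>UNIV. of_int (k i) * coroot G (sroot G i) x)"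
    using assms unfolding coroot_lattice_def by blast
  then have "m = (\<lambda>x. \<Sum>i\<in>UNIV. of_int (k i) * 2 / pairing G (sroot G i) (sroot G i) * sroot G i x)"
    by (simp add: coroot_def mult.assoc)
  then show ?thesis by (simp only:) (intro hstar_sum hstar_mult sroot_hstar)
qed

end

section \<open>Weight projections\<close>

text \<open>Eigenvector argument: applying \<open>\<rho> (\<iota> t)\<close> minus the scalar
  \<open>\<sigma> t\<close> to the relation removes the summand of weight \<open>\<sigma>\<close>
  and multiplies the others by \<open>\<nu> t - \<sigma> t\<close>, so the induction hypothesis
  applies to the rescaled family.\<close>

lemma weight_vectors_independent:
  assumes "vector_space vs" and lin: "\<And>y. Vector_Spaces.linear vs vs (\<rho> y)"
    and "finite S" "S \<subseteq> hstar G"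
    and "\<And>\<nu>. \<nu> \<in> S \<Longrightarrow> v \<nu> \<in> weight_space G \<iota> vs \<rho> \<nu>"
    and "(\<Sum>\<nu>\<in>S. v \<nu>) = 0" and "\<nu> \<in> S"
  shows "v \<nu> = 0"
  using assms(3-)
proof (induction S arbitrary: v \<nu> rule: finite_induct)
  case (insert \<sigma> S)
  interpret vector_space vs by fact
  interpret vp: vector_space_pair vs vs by unfold_locales
  have weight: "\<rho> (\<iota> t) (v \<nu>) = vs (\<nu> t) (v \<nu>)" if "\<nu> \<in> insert \<sigma> S" "t \<in> cartan G" for \<nu> t
    using insert.prems(2)[OF that(1)] that(2) by (simp add: weight_space_def)
  have 0: "v \<nu> = 0" if \<nu>: "\<nu> \<in> S" for \<nu>
  proof -
    \<comment> \<open>Weights vanish outside the Cartan subalgebra, so two distinct ones must differ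
      at a point inside it.\<close>
    obtain t where t: "t \<in> cartan G" "\<nu> t \<noteq> \<sigma> t"
      using \<nu> insert.hyps(2) insert.prems(1) hstar_outside[of \<nu> G] hstar_outside[of \<sigma> G]
      by (metis ext insert_subset subsetD)
    have "vs (\<nu> t - \<sigma> t) (v \<nu>) = 0"
    proof (rule insert.IH[where v = "\<lambda>\<nu>. vs (\<nu> t - \<sigma> t) (v \<nu>)"])
      show "vs (\<tau> t - \<sigma> t) (v \<tau>) \<in> weight_space G \<iota> vs \<rho> \<tau>" if "\<tau> \<in> S" for \<tau>
        using insert.prems(2)[of \<tau>] that
        by (simp add: weight_space_def vp.linear_scale[OF lin] mult.commute)
      have "(\<Sum>\<tau>\<in>S. vs (\<tau> t - \<sigma> t) (v \<tau>)) = (\<Sum>\<tau>\<in>insert \<sigma> S. vs (\<tau> t - \<sigma> t) (v \<tau>))"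
        using insert.hyps by simp
      also have "\<dots> = (\<Sum>\<tau>\<in>insert \<sigma> S. \<rho> (\<iota> t) (v \<tau>)) - vs (\<sigma> t) (\<Sum>\<tau>\<in>insert \<sigma> S. v \<tau>)"
        using weight[OF _ t(1)]
        by (simp only: scale_left_diff_distrib sum_subtractf scale_sum_right cong: sum.cong)
      also have "\<dots> = 0"
        unfolding vp.linear_sum[OF lin, symmetric] insert.prems(3) by (simp add: vp.linear_0[OF lin])
      finally show "(\<Sum>\<tau>\<in>S. vs (\<tau> t - \<sigma> t) (v \<tau>)) = 0" .
    qed (use insert.prems \<nu> in auto)
    then show ?thesis using t by simp
  qed
  moreover have "v \<sigma> = 0" using insert.hyps insert.prems(3) 0 by simp
  ultimately show ?case using insert.prems(4) by auto
qed simp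

text \<open>The definition asks for weight components but not for linear projections. Independence
  of weight vectors makes the components unique. Uniqueness then yields linearity, orthogonality and
  commutation with every linear map that preserves the weight spaces.\<close>

lemma weight_decomposition_graded_tvs:
  assumes tvs: "complex_tvs vs" and lin: "\<And>y. Vector_Spaces.linear vs vs (\<rho> y)"
    and "weight_decomposition G \<iota> vs \<rho>"
  shows "\<exists>P. graded_tvs vs (hstar G) P \<and>
    (\<forall>\<nu>\<in>hstar G. \<forall>v. P \<nu> v \<in> weight_space G \<iota> vs \<rho> \<nu>) \<and>
    (\<forall>B. Vector_Spaces.linear vs vs B \<longrightarrow>
       (\<forall>\<nu>\<in>hstar G. \<forall>v\<in>weight_space G \<iota> vs \<rho> \<nu>. B v \<in> weight_space G \<iota> vs \<rho> \<nu>) \<longrightarrow>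
       (\<forall>\<nu>\<in>hstar G. \<forall>v. P \<nu> (B v) = B (P \<nu> v)))"
proof -
  interpret complex_tvs vs by fact
  interpret vp: vector_space_pair vs vs by unfold_locales
  let ?V = "weight_space G \<iota> vs \<rho>"
  have sub: "subspace (?V \<nu>)" for \<nu>
    by (auto simp: subspace_def weight_space_def vp.linear_0[OF lin] vp.linear_add[OF lin]
        vp.linear_scale[OF lin] scale_right_distrib mult.commute)
  obtain P where PV: "\<And>\<nu> v. \<nu> \<in> hstar G \<Longrightarrow> P \<nu> v \<in> ?V \<nu>"
    and fin: "\<And>v. finite {\<nu>\<in>hstar G. P \<nu> v \<noteq> 0}"
    and sum: "\<And>v. v = (\<Sum>\<nu> | \<nu> \<in> hstar G \<and> P \<nu> v \<noteq> 0. P \<nu> v)"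
    and nhds: "\<And>v. nhds v = (INF \<nu>\<in>hstar G. filtercomap (P \<nu>) (nhds (P \<nu> v)))"
    using assms(3) unfolding weight_decomposition_def by blast
  have sum': "(\<Sum>\<nu>\<in>T. P \<nu> v) = v" if "finite T" "T \<subseteq> hstar G" "{\<nu>\<in>hstar G. P \<nu> v \<noteq> 0} \<subseteq> T" for T v
  proof -
    have "(\<Sum>\<nu>\<in>T. P \<nu> v) = (\<Sum>\<nu> | \<nu> \<in> hstar G \<and> P \<nu> v \<noteq> 0. P \<nu> v)"
      using that by (intro sum.mono_neutral_right) auto
    then show ?thesis by (simp only: sum[symmetric])
  qed
  \<comment> \<open>Two decompositions of \<open>v\<close> are compared over a finite index set
    containing both supports and \<open>\<nu>\<close>. Their difference is a vanishing sum of weight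
    vectors.\<close>
  have unique: "P \<nu> v = (if \<nu> \<in> S then u \<nu> else 0)"
    if S: "finite S" "S \<subseteq> hstar G" and u: "\<And>\<sigma>. \<sigma> \<in> S \<Longrightarrow> u \<sigma> \<in> ?V \<sigma>"
      and v: "v = (\<Sum>\<sigma>\<in>S. u \<sigma>)" and \<nu>: "\<nu> \<in> hstar G" for S u v \<nu>
  proof -
    let ?T = "insert \<nu> (S \<union> {\<nu>\<in>hstar G. P \<nu> v \<noteq> 0})"
    let ?u = "\<lambda>\<sigma>. if \<sigma> \<in> S then u \<sigma> else 0"
    have T: "finite ?T" "?T \<subseteq> hstar G" using S \<nu> fin by auto
    have "P \<nu> v - ?u \<nu> = 0"
    proof (rule weight_vectors_independent[where S = ?T and v = "\<lambda>\<sigma>. P \<sigma> v - ?u \<sigma>"])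
      show "P \<sigma> v - ?u \<sigma> \<in> ?V \<sigma>" if "\<sigma> \<in> ?T" for \<sigma>
        using T that u by (intro subspace_diff sub PV) (auto simp: subspace_0[OF sub])
      have "(\<Sum>\<sigma>\<in>?T. P \<sigma> v) = v" using T by (intro sum') auto
      moreover have "(\<Sum>\<sigma>\<in>?T. ?u \<sigma>) = (\<Sum>\<sigma>\<in>S. u \<sigma>)"
        using T by (intro sum.mono_neutral_cong_right) auto
      ultimately show "(\<Sum>\<sigma>\<in>?T. P \<sigma> v - ?u \<sigma>) = 0" 
        by (simp only: sum_subtractf v[symmetric] diff_self)
    qed (use T vector_space lin in auto)
    then show ?thesis by simp
  qed
  have commute: "P \<nu> (B v) = B (P \<nu> v)"
    if B: "Vector_Spaces.linear vs vs B" and BV: "\<forall>\<nu>\<in>hstar G. \<forall>v\<in>?V \<nu>. B v \<in> ?V \<nu>"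
      and \<nu>: "\<nu> \<in> hstar G" for B \<nu> v
  proof -
    let ?S = "{\<nu>\<in>hstar G. P \<nu> v \<noteq> 0}"
    have "B v = (\<Sum>\<sigma>\<in>?S. B (P \<sigma> v))"
      using arg_cong[OF sum[of v], of B] by (simp only: vp.linear_sum[OF B])
    then have "P \<nu> (B v) = (if \<nu> \<in> ?S then B (P \<nu> v) else 0)"
      using fin \<nu> by (intro unique) (auto simp: BV PV)
    then show ?thesis using \<nu> by (auto simp: vp.linear_0[OF B])
  qed
  have add: "P \<nu> (v + w) = P \<nu> v + P \<nu> w" if \<nu>: "\<nu> \<in> hstar G" for \<nu> v w
  proof -
    let ?S = "{\<nu>\<in>hstar G. P \<nu> v \<noteq> 0} \<union> {\<nu>\<in>hstar G. P \<nu> w \<noteq> 0}"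
    have S: "finite ?S" "?S \<subseteq> hstar G" using fin by auto
    have "v + w = (\<Sum>\<sigma>\<in>?S. P \<sigma> v + P \<sigma> w)"
      using sum'[of ?S v] sum'[of ?S w] S by (simp add: sum.distrib)
    then have "P \<nu> (v + w) = (if \<nu> \<in> ?S then P \<nu> v + P \<nu> w else 0)"
      using S \<nu> by (intro unique) (auto intro: subspace_add[OF sub] PV)
    then show ?thesis using \<nu> by auto
  qed
  \<comment> \<open>Scaling by \<open>c\<close> is itself a linear map preserving weight spaces, so
    homogeneity is an instance of \<open>commute\<close>.\<close>
  have scale: "P \<nu> (vs c v) = vs c (P \<nu> v)" if "\<nu> \<in> hstar G" for \<nu> c v
    using that by (intro commute linear_scale_self ballI subspace_scale[OF sub])
  have "graded_tvs vs (hstar G) P"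
  proof (intro graded_tvs.intro graded_tvs_axioms.intro tvs)
    show "Vector_Spaces.linear vs vs (P \<nu>)" if "\<nu> \<in> hstar G" for \<nu>
      using that by (unfold_locales) (simp_all add: add scale)
    show "P \<nu> (P \<sigma> v) = (if \<nu> = \<sigma> then P \<sigma> v else 0)" if "\<nu> \<in> hstar G" "\<sigma> \<in> hstar G" for \<nu> \<sigma> v
    proof -
      have "P \<nu> (P \<sigma> v) = (if \<nu> \<in> {\<sigma>} then P \<nu> v else 0)"
        by (rule unique) (simp_all add: that PV)
      then show ?thesis by simp
    qed
    show "finite {\<nu>\<in>hstar G. P \<nu> v \<noteq> 0}" for v by (rule fin)
    show "(\<Sum>\<nu> | \<nu> \<in> hstar G \<and> P \<nu> v \<noteq> 0. P \<nu> v) = v" for v by (rule sum[symmetric])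
    show "nhds v = (INF \<nu>\<in>hstar G. filtercomap (P \<nu>) (nhds (P \<nu> v)))" for v by (rule nhds)
  qed
  then show ?thesis
    by (intro exI[of _ P] conjI allI impI ballI) (assumption | rule PV commute)+
qed


section \<open>The centralizer of the Cartan subalgebra\<close>

context is_yangian
begin

sublocale vector_space "yscale Y"
  by (rule vector_space)

text \<open>For distinct generators the commutator is supported on two words with coefficients 1 and
  -1. Equal generators are treated apart because the two words then coincide and cancel.\<close>

lemma free_eval_commutator_gen:
  "free_eval (yscale Y) g (commutator (gen x) (gen y)) = g x * g y - g y * g x"
proof (cases "x = y")
  case True
  then show ?thesis by (simp add: commutator_def free_eval_def)
next
  case False
  let ?u = "Word [x, y]" and ?v = "Word [y, x]" and ?p = "commutator (gen x) (gen y)"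
  have uv: "?u \<noteq> ?v" using False by simp
  have "?p = Poly_Mapping.single ?u 1 - Poly_Mapping.single ?v 1"
    by (simp add: commutator_def gen_def mult_single plus_word_def)
  then have lookup: "Poly_Mapping.lookup ?p w = (if w = ?u then 1 else if w = ?v then - 1 else 0)" for w
    using uv by (auto simp: lookup_minus lookup_single when_def)
  have keys: "Poly_Mapping.keys ?p = {?u, ?v}"
    by (rule set_eqI) (simp add: in_keys_iff lookup)
  show ?thesis
    using uv by (simp add: free_eval_def keys lookup)
qed

text \<open>The commutator of the two free generators is a relator, hence lies in the kernel of
  evaluation.\<close>

lemma yT_commute: "yT Y i r * yT Y j s = yT Y j s * yT Y i r"
proof -
  have "commutator (gen (TG i r)) (gen (TG j s)) \<in> generated_ideal (yangian_relators a d)"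
    by (intro generated_ideal.base yangian_relators.TT)
  then have "free_eval (yscale Y) (yangian_val Y) (commutator (gen (TG i r)) (gen (TG j s))) = 0"
    using presented by blast
  then show ?thesis
    unfolding free_eval_commutator_gen by (simp add: yangian_val_def)
qed

end

lemma commute_sum:
  fixes x :: "'y::ring"
  assumes "\<And>i. i \<in> I \<Longrightarrow> x * y i = y i * x"
  shows "x * (\<Sum>i\<in>I. y i) = (\<Sum>i\<in>I. y i) * x"
  using assms by (simp add: sum_distrib_left sum_distrib_right cong: sum.cong)

lemma commute_mult:
  fixes x :: "'y::semigroup_mult"
  assumes "x * y = y * x" "x * z = z * x"
  shows "x * (y * z) = y * z * x"
  using assms by (metis mult.assoc)

section \<open>Yangian elements of weight zero and the comparison of the two differential
  operators\<close>

locale yangian_module =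
  simple_chevalley_datum G + Y: is_yangian "cmat G" "csym G" Y +
  V: complex_tvs vs + M: algebra_module "yscale Y" vs \<rho>
  for G :: "('g::ab_group_add, 'i::finite) chevalley_datum"
    and Y :: "('i, 'y::ring_1) yangian"
    and vs :: "complex \<Rightarrow> 'v::{topological_ab_group_add, t2_space} \<Rightarrow> 'v"
    and \<rho> :: "'y \<Rightarrow> 'v \<Rightarrow> 'v" +
  fixes \<iota> T1 :: "'g \<Rightarrow> 'y"
  assumes embedding: "yangian_embedding G Y \<iota>" and T1: "is_T1 G Y T1"
begin

sublocale VV: vector_space_pair vs vs
  by unfold_locales

sublocale \<iota>: vector_space_pair "lscale G" "yscale Y"
  by unfold_locales

lemma \<iota>_linear: "Vector_Spaces.linear (lscale G) (yscale Y) \<iota>"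
  and \<iota>_lbr: "\<iota> (lbr G x y) = commutator (\<iota> x) (\<iota> y)"
  and \<iota>_hvec_sroot: "\<iota> (hvec G (sroot G i)) = yT Y i 0"
  using embedding by (simp_all add: yangian_embedding_def)

lemma commute_scale:
  assumes "x * y = y * x"
  shows "x * yscale Y c y = yscale Y c y * x"
  using assms by (simp add: Y.scale_mult_left Y.scale_mult_right)

lemma \<iota>_cartan:
  assumes "t \<in> cartan G"
  shows "\<exists>c. \<iota> t = (\<Sum>i\<in>UNIV. yscale Y (c i) (yT Y i 0))"
proof -
  obtain c where "t = (\<Sum>i\<in>UNIV. lscale G (c i) (hvec G (sroot G i)))"
    using cartan_sum_hvec[OF assms] by blast
  then have "\<iota> t = (\<Sum>i\<in>UNIV. yscale Y (c i) (yT Y i 0))"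
    by (simp add: \<iota>.linear_sum[OF \<iota>_linear] \<iota>.linear_scale[OF \<iota>_linear] \<iota>_hvec_sroot)
  then show ?thesis by (intro exI[of _ c])
qed

lemma T1_cartan:
  assumes "t \<in> cartan G"
  shows "\<exists>c. T1 t = (\<Sum>i\<in>UNIV. yscale Y (c i) (yT Y i 1))"
proof -
  obtain c where c: "t = (\<Sum>i\<in>UNIV. lscale G (c i) (hvec G (sroot G i)))"
    using cartan_sum_hvec[OF assms] by blast
  have add: "T1 (x + y) = T1 x + T1 y" and scale: "T1 (lscale G k x) = yscale Y k (T1 x)"
    if "x \<in> cartan G" "y \<in> cartan G" for x y k
    using T1 that by (simp_all add: is_T1_def)
  have T: "T1 (hvec G (sroot G i)) = yT Y i 1" for i
    using T1 by (simp add: is_T1_def)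
  have h: "lscale G (c i) (hvec G (sroot G i)) \<in> cartan G" for i
    by (intro subspace_scale cartan_subspace hvec_cartan sroot_hstar)
  have "T1 0 = 0" using add[of 0 0] subspace_0[OF cartan_subspace] by simp
  \<comment> \<open>\<open>T1\<close> is linear on the Cartan subalgebra only, so the induction over
    \<open>I\<close> also needs the partial sums to stay there.\<close>
  then have "T1 (\<Sum>i\<in>I. lscale G (c i) (hvec G (sroot G i))) = (\<Sum>i\<in>I. yscale Y (c i) (yT Y i 1))" for I
    by (induction I rule: infinite_finite_induct)
      (simp_all add: add scale[OF hvec_cartan[OF sroot_hstar] hvec_cartan[OF sroot_hstar]] h T
        subspace_sum[OF cartan_subspace])
  then show ?thesis using c by blast
qed

lemma \<iota>_cartan_commute_yT:
  assumes "t \<in> cartan G"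
  shows "\<iota> t * yT Y i r = yT Y i r * \<iota> t"
proof -
  obtain c where "\<iota> t = (\<Sum>i\<in>UNIV. yscale Y (c i) (yT Y i 0))"
    using \<iota>_cartan[OF assms] by blast
  then show ?thesis
    by (simp only:) (intro commute_sum[symmetric] commute_scale Y.yT_commute)
qed

lemma \<iota>_cartan_commute:
  assumes "t \<in> cartan G" "x \<in> cartan G"
  shows "\<iota> t * \<iota> x = \<iota> x * \<iota> t"
proof -
  obtain c where "\<iota> x = (\<Sum>i\<in>UNIV. yscale Y (c i) (yT Y i 0))"
    using \<iota>_cartan[OF assms(2)] by blast
  then show ?thesis
    by (simp only:) (intro commute_sum commute_scale \<iota>_cartan_commute_yT[OF assms(1)])
qed

lemma \<iota>_cartan_commute_T1:
  assumes "t \<in> cartan G" "x \<in> cartan G"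
  shows "\<iota> t * T1 x = T1 x * \<iota> t"
proof -
  obtain c where "T1 x = (\<Sum>i\<in>UNIV. yscale Y (c i) (yT Y i 1))"
    using T1_cartan[OF assms(2)] by blast
  then show ?thesis
    by (simp only:) (intro commute_sum commute_scale \<iota>_cartan_commute_yT[OF assms(1)])
qed

text \<open>The product has weight zero: moving \<open>\<iota> t\<close> past
  \<open>xminus G a\<close> costs \<open>- a t\<close>, past \<open>xplus G a\<close> it costs
  \<open>a t\<close>, and the two corrections cancel.\<close>

lemma \<iota>_cartan_commute_root_vectors:
  assumes t: "t \<in> cartan G" and a: "a \<in> pos_roots G"
  shows "\<iota> t * (\<iota> (xminus G a) * \<iota> (xplus G a)) = \<iota> (xminus G a) * \<iota> (xplus G a) * \<iota> t"
proof -
  let ?p = "\<iota> (xplus G a)" and ?m = "\<iota> (xminus G a)" and ?s = "yscale Y (a t)"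
  have "commutator (\<iota> t) ?p = ?s ?p" "commutator (\<iota> t) ?m = - ?s ?m"
    unfolding \<iota>_lbr[symmetric] using xplus[OF a] xminus[OF a] t
    by (simp_all add: root_space_def \<iota>.linear_scale[OF \<iota>_linear] \<iota>.linear_neg[OF \<iota>_linear])
  then have "\<iota> t * ?p = ?p * \<iota> t + ?s ?p" "\<iota> t * ?m = ?m * \<iota> t - ?s ?m"
    unfolding commutator_def diff_eq_eq by simp_all
  then have "\<iota> t * ?m * ?p = ?m * ?p * \<iota> t"
    by (simp add: left_diff_distrib distrib_left mult.assoc Y.scale_mult_left Y.scale_mult_right)
  then show ?thesis by (simp add: mult.assoc)
qed

lemma \<iota>_cartan_commute_D_op:
  assumes t: "t \<in> cartan G" and \<mu>: "\<mu> \<in> hstar G"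
  shows "\<iota> t * D_op G Y \<iota> T1 \<kappa> \<mu> l = D_op G Y \<iota> T1 \<kappa> \<mu> l * \<iota> t"
proof -
  have add: "\<iota> t * (y + z) = (y + z) * \<iota> t" if "\<iota> t * y = y * \<iota> t" "\<iota> t * z = z * \<iota> t" for y z
    using that by (simp add: algebra_simps)
  show ?thesis
    unfolding D_op_def power2_eq_square
    by (intro commute_scale add commute_sum commute_mult[of "\<iota> t" "\<iota> (hvec G (sroot G _))"]
        \<iota>_cartan_commute_T1 \<iota>_cartan_commute \<iota>_cartan_commute_root_vectors t hvec_cartan sroot_hstar \<mu>)
qed

text \<open>Reordering \<open>xplus\<close> and \<open>xminus\<close> produces their bracket, which
  is \<open>hvec G a\<close>.\<close>

lemma casimir_K_eq:
  assumes "a \<in> pos_roots G"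
  shows "casimir_K G \<iota> a = \<iota> (hvec G a) + yscale Y 2 (\<iota> (xminus G a) * \<iota> (xplus G a))"
proof -
  have "\<iota> (hvec G a) = commutator (\<iota> (xplus G a)) (\<iota> (xminus G a))"
    using lbr_xplus_xminus[OF assms] \<iota>_lbr by metis
  then show ?thesis
    using Y.scale_left_distrib[of 1 1] by (simp add: casimir_K_def commutator_def)
qed

text \<open>Taking \<open>b = - 2 * \<kappa>\<close> flips the sign of the prefactor, and evaluating
  \<open>D_op\<close> at \<open>- l\<close> turns its exponentials into those of the Casimir
  equation. What remains is the Cartan term from reordering root vectors, to be matched by the gauge
  factor.\<close>

lemma trig_casimir_eq_D_op:
  assumes l: "l \<in> hstar G" and \<mu>: "\<mu> \<in> hstar G"
  shows "trig_casimir G Y \<iota> T1 (- 2 * \<kappa>) \<mu> l =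
    (\<Sum>a\<in>pos_roots G. yscale Y (- 1 / (2 * \<kappa>) * (pairing G a \<mu> / (exp (pairing G a l) - 1))) (\<iota> (hvec G a)))
      - D_op G Y \<iota> T1 \<kappa> \<mu> (- l)"
proof -
  let ?c = "\<lambda>a. pairing G a \<mu> / (exp (pairing G a l) - 1)"
  let ?E = "\<lambda>a. yscale Y 2 (\<iota> (xminus G a) * \<iota> (xplus G a))"
  let ?T = "yscale Y (- 2) (T1 (hvec G \<mu>))
    + (\<Sum>i\<in>UNIV. yscale Y (coweight G i (hvec G \<mu>)) ((\<iota> (hvec G (sroot G i)))\<^sup>2))"
  have neg: "pairing G (- l) a = - pairing G a l" if "a \<in> pos_roots G" for a
  proof -
    have "- l \<in> hstar G" using hstar_mult[OF l, of "- 1"] by (simp add: fun_Compl_def)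
    then show ?thesis unfolding pairing_sym[of a l] using l that by (simp add: pairing_hvec pos_root_hstar)
  qed
  have coweight: "pairing G (coweight G i) \<mu> = coweight G i (hvec G \<mu>)" for i
    by (rule pairing_hvec[OF coweight_hstar \<mu>])
  have "D_op G Y \<iota> T1 \<kappa> \<mu> (- l) = yscale Y (1 / (2 * \<kappa>)) (?T + (\<Sum>a\<in>pos_roots G. yscale Y (?c a) (?E a)))"
    unfolding D_op_def by (simp add: neg cong: sum.cong)
  moreover have "trig_casimir G Y \<iota> T1 (- 2 * \<kappa>) \<mu> l =
      yscale Y (- 1 / (2 * \<kappa>)) (?T + (\<Sum>a\<in>pos_roots G. yscale Y (?c a) (\<iota> (hvec G a) + ?E a)))"
    unfolding trig_casimir_def
    by (simp add: casimir_K_eq coweight add_ac cong: sum.cong)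
  ultimately show ?thesis
    by (simp add: Y.scale_right_distrib sum.distrib sum_negf Y.scale_sum_right)
qed

lemma \<rho>_preserves_weight_space:
  assumes y: "\<And>t. t \<in> cartan G \<Longrightarrow> \<iota> t * y = y * \<iota> t" and v: "v \<in> weight_space G \<iota> vs \<rho> \<nu>"
  shows "\<rho> y v \<in> weight_space G \<iota> vs \<rho> \<nu>"
  unfolding weight_space_def
proof (safe)
  fix t assume t: "t \<in> cartan G"
  have "\<rho> (\<iota> t) (\<rho> y v) = \<rho> y (\<rho> (\<iota> t) v)"
    by (simp add: y[OF t] flip: M.act_mult)
  also have "\<dots> = vs (\<nu> t) (\<rho> y v)"
    using v t by (simp add: weight_space_def VV.linear_scale[OF M.linear])
  finally show "\<rho> (\<iota> t) (\<rho> y v) = vs (\<nu> t) (\<rho> y v)" .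
qed

lemma act_sum: "\<rho> (\<Sum>i\<in>I. y i) v = (\<Sum>i\<in>I. \<rho> (y i) v)"
proof -
  have "\<rho> 0 v = 0" using M.act_add[of 0 0 v] by simp
  then show ?thesis by (induction I rule: infinite_finite_induct) (simp_all add: M.act_add)
qed

end

section \<open>Derivatives along lines\<close>

text \<open>Near \<open>z\<close> a continuous branch coincides with
  \<open>f z + Ln (e w / e z)\<close>. The quotient is close to 1, away from the cut of the
  principal logarithm, so the derivative is that of this explicit function.\<close>

lemma has_field_derivative_log_branch:
  fixes f e :: "complex \<Rightarrow> complex"
  assumes e: "(e has_field_derivative e') (at z)" and f: "isCont f z"
    and ev: "\<forall>\<^sub>F w in nhds z. exp (f w) = e w"
  shows "(f has_field_derivative e' / e z) (at z)"
proof -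
  have ez: "exp (f z) = e z" using ev by (rule eventually_nhds_x_imp_x)
  then have "e z \<noteq> 0" by (metis exp_not_eq_zero)
  then have "((\<lambda>w. f z + Ln (e w / e z)) has_field_derivative e' / e z) (at z)"
    by (auto intro!: derivative_eq_intros e)
  moreover have "\<forall>\<^sub>F w in nhds z. f z + Ln (e w / e z) = f w"
  proof -
    have "((\<lambda>w. f w - f z) \<longlongrightarrow> 0) (nhds z)"
      using f by (simp add: LIM_zero_iff tendsto_at_iff_tendsto_nhds[symmetric] isCont_def)
    \<comment> \<open>The bound \<open>pi\<close> keeps \<open>f w - f z\<close> inside the strip on
      which \<open>Ln\<close> inverts \<open>exp\<close>.\<close>
    then have "\<forall>\<^sub>F w in nhds z. norm (f w - f z) < pi"
      using tendstoD[of "\<lambda>w. f w - f z" 0 "nhds z" pi] by (simp add: dist_norm)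
    then show ?thesis using ev
    proof eventually_elim
      case (elim w)
      have "Ln (exp (f w - f z)) = f w - f z"
        using elim(1) abs_Im_le_cmod[of "f w - f z"] by (intro Ln_exp) linarith+
      then show ?case by (simp add: exp_diff elim(2) ez)
    qed
  qed
  ultimately show ?thesis by (simp only: DERIV_cong_ev[OF refl _ refl])
qed

text \<open>The line is continuous into the topology of pointwise convergence and stays in
  \<open>hstar G\<close>, so a relatively open set pulls back to an open set of parameters.\<close>

lemma openin_hstar_line:
  assumes U: "openin (top_of_set (hstar G)) U" and l: "l \<in> U" and \<mu>: "\<mu> \<in> hstar G"
  obtains S where "open S" "0 \<in> S" "\<And>z. z \<in> S \<Longrightarrow> (\<lambda>x. l x + z * \<mu> x) \<in> U"
    and "continuous_on S (\<lambda>z x. l x + z * \<mu> x)"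
proof -
  let ?c = "\<lambda>(z::complex) x. l x + z * \<mu> x"
  obtain T where T: "open T" "U = hstar G \<inter> T" using U by (auto simp: openin_open)
  have c: "continuous_on UNIV ?c"
    by (intro continuous_on_coordinatewise_then_product continuous_intros)
  show ?thesis
  proof (rule that[of "?c -` T"])
    show "open (?c -` T)" using c T by (simp add: open_vimage)
    show "0 \<in> ?c -` T" using l T by simp
    show "?c z \<in> U" if "z \<in> ?c -` T" for z
      using that l T \<mu> by (auto intro: hstar_add_mult)
    show "continuous_on (?c -` T) ?c" using c by (rule continuous_on_subset) simp
  qed
qed

text \<open>Along the line the pairing with \<open>a\<close> is affine in \<open>z\<close>, so this
  is the logarithmic derivative of an exponential minus 1. Cancelling
  \<open>exp (- pairing G l a)\<close> brings it to the coefficient in the Casimir equation, with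
  regularity keeping the denominators nonzero.\<close>

lemma (in simple_chevalley_datum) has_field_derivative_log_branch_line:
  assumes U: "openin (top_of_set (hstar G)) U" "U \<subseteq> regular_points G"
    and l: "l \<in> U" and \<mu>: "\<mu> \<in> hstar G" and a: "a \<in> pos_roots G"
    and L: "log_branch_on U (\<lambda>l. exp (- pairing G l a) - 1) L"
  shows "((\<lambda>z. L (\<lambda>x. l x + z * \<mu> x)) has_field_derivative
           pairing G a \<mu> / (exp (pairing G a l) - 1)) (at 0)"
proof -
  obtain S where S: "open S" "0 \<in> S" "\<And>z. z \<in> S \<Longrightarrow> (\<lambda>x. l x + z * \<mu> x) \<in> U"
    and cont: "continuous_on S (\<lambda>z x. l x + z * \<mu> x)"
    using openin_hstar_line[OF U(1) l \<mu>] by blast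
  let ?e = "\<lambda>z. exp (- (pairing G a l + z * pairing G a \<mu>)) - 1"
  have lh: "l \<in> hstar G" and reg: "exp (pairing G a l) \<noteq> 1"
    using U(2) l a by (auto simp: regular_points_def pairing_sym[of a])
  have e: "exp (- pairing G (\<lambda>x. l x + z * \<mu> x) a) - 1 = ?e z" for z
    unfolding pairing_sym[of a]
    by (simp add: pairing_hvec hstar_add_mult lh \<mu> pos_root_hstar[OF a])
  have "((\<lambda>z. L (\<lambda>x. l x + z * \<mu> x)) has_field_derivative
           - pairing G a \<mu> * exp (- pairing G a l) / ?e 0) (at 0)"
  proof (rule has_field_derivative_log_branch)
    show "(?e has_field_derivative - pairing G a \<mu> * exp (- pairing G a l)) (at 0)"
      by (auto intro!: derivative_eq_intros)
    have "continuous_on S (\<lambda>z. L (\<lambda>x. l x + z * \<mu> x))"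
      using L S(3) by (intro continuous_on_compose2[OF _ cont]) (auto simp: log_branch_on_def)
    then show "isCont (\<lambda>z. L (\<lambda>x. l x + z * \<mu> x)) 0"
      using S by (simp add: continuous_on_eq_continuous_at)
    show "\<forall>\<^sub>F z in nhds 0. exp (L (\<lambda>x. l x + z * \<mu> x)) = ?e z"
      using L S(3) by (intro eventually_nhds_in_open[OF S(1,2), THEN eventually_mono])
        (simp add: log_branch_on_def e)
  qed
  moreover have "- pairing G a \<mu> * exp (- pairing G a l) / ?e 0
      = pairing G a \<mu> / (exp (pairing G a l) - 1)"
    using reg by (simp add: exp_minus divide_simps) (simp add: algebra_simps)
  ultimately show ?thesis by simp
qed


section \<open>The gauge transformation\<close>

text \<open>The powers depend on a branch of the logarithm, so the claim is local: \<open>U\<close>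
  is relatively open, consists of regular points and carries a branch for each positive root. The
  equation for \<open>g\<close> is posed on the reflected set because the transform evaluates
  \<open>g\<close> at \<open>- l\<close>.\<close>

theorem corollary8:
  fixes G :: "('g::ab_group_add, 'i::finite) chevalley_datum"
    and Y :: "('i, 'y::ring_1) yangian"
    and \<iota> T1 :: "'g \<Rightarrow> 'y"
    and vs :: "complex \<Rightarrow> 'v::{topological_ab_group_add, t2_space} \<Rightarrow> 'v"
    and \<rho> :: "'y \<Rightarrow> 'v \<Rightarrow> 'v"
    and \<mu> :: "'g \<Rightarrow> complex" and \<kappa> :: complex
    and U :: "('g \<Rightarrow> complex) set"
    and L :: "('g \<Rightarrow> complex) \<Rightarrow> ('g \<Rightarrow> complex) \<Rightarrow> complex"
    and g :: "('g \<Rightarrow> complex) \<Rightarrow> 'v"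
  assumes "simple_chevalley_datum G"
    and "is_yangian (cmat G) (csym G) Y"
    and "yangian_embedding G Y \<iota>"
    and "is_T1 G Y T1"
    and "complex_tvs vs"
    and "algebra_module (yscale Y) vs \<rho>"
    and "weight_decomposition G \<iota> vs \<rho>"
    and "\<mu> \<in> coroot_lattice G"
    and "\<kappa> \<noteq> 0"
    and "openin (top_of_set (hstar G)) U"
    and "U \<subseteq> regular_points G"
    and "\<And>a. a \<in> pos_roots G \<Longrightarrow> log_branch_on U (\<lambda>l. exp (- pairing G l a) - 1) (L a)"
    and "solves_on vs \<rho> \<mu> (D_op G Y \<iota> T1 \<kappa> \<mu>) g (uminus ` U)"
  shows "solves_on vs \<rho> \<mu> (trig_casimir G Y \<iota> T1 (- 2 * \<kappa>) \<mu>)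
           (gauge_transform G Y \<iota> vs \<rho> \<kappa> L g) U"
proof -
  interpret yangian_module G Y vs \<rho> \<iota> T1
    using assms(1-6) by (intro yangian_module.intro yangian_module_axioms.intro)
  have \<mu>: "\<mu> \<in> hstar G" by (rule coroot_lattice_hstar[OF assms(8)])
  obtain P where P: "graded_tvs vs (hstar G) P"
    and PV: "\<forall>\<nu>\<in>hstar G. \<forall>v. P \<nu> v \<in> weight_space G \<iota> vs \<rho> \<nu>"
    and commute: "\<forall>B. Vector_Spaces.linear vs vs B \<longrightarrow>
       (\<forall>\<nu>\<in>hstar G. \<forall>v\<in>weight_space G \<iota> vs \<rho> \<nu>. B v \<in> weight_space G \<iota> vs \<rho> \<nu>) \<longrightarrow>
       (\<forall>\<nu>\<in>hstar G. \<forall>v. P \<nu> (B v) = B (P \<nu> v))"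
    using weight_decomposition_graded_tvs[OF assms(5) M.linear assms(7)] by (elim exE conjE)
  interpret P: graded_tvs vs "hstar G" P by (rule P)
  \<comment> \<open>An element commuting with the image of the Cartan subalgebra preserves weight
    spaces, hence its action commutes with the projections.\<close>
  have P_\<rho>: "P \<nu> (\<rho> y v) = \<rho> y (P \<nu> v)"
    if "\<nu> \<in> hstar G" "\<And>t. t \<in> cartan G \<Longrightarrow> \<iota> t * y = y * \<iota> t" for \<nu> y v
    using that by (intro commute[rule_format] M.linear \<rho>_preserves_weight_space)
  have P_\<iota>: "\<rho> (\<iota> (hvec G a)) (P \<nu> v) = vs (\<nu> (hvec G a)) (P \<nu> v)"
    if "\<nu> \<in> hstar G" "a \<in> pos_roots G" for \<nu> a v
    using bspec[OF PV that(1)] hvec_cartan[OF pos_root_hstar[OF that(2)]] by (simp add: weight_space_def)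
  let ?gt = "gauge_transform G Y \<iota> vs \<rho> \<kappa> L g"
  let ?b = "- 1 / (2 * \<kappa>)"
  define E where "E \<nu> l = exp (\<Sum>a\<in>pos_roots G. L a l * (?b * \<nu> (hvec G a)))" for \<nu> l
  have P_gt: "P \<nu> (?gt l) = vs (E \<nu> l) (P \<nu> (g (- l)))" if "\<nu> \<in> hstar G" for \<nu> l
    unfolding gauge_transform_def E_def
  proof (rule P.P_fold_op_exp[OF _ that])
    fix a \<nu> v assume a: "a \<in> pos_roots G" and \<nu>: "\<nu> \<in> hstar G"
    have "P \<nu> (\<rho> (\<iota> (hvec G a)) v) = vs (\<nu> (hvec G a)) (P \<nu> v)"
      using \<iota>_cartan_commute hvec_cartan[OF pos_root_hstar[OF a]] P_\<iota>[OF \<nu> a]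
      by (subst P_\<rho>[OF \<nu>]) auto
    then show "P \<nu> (vs (L a l) (\<rho> (yscale Y ?b (\<iota> (hvec G a))) v))
        = vs (L a l * (?b * \<nu> (hvec G a))) (P \<nu> v)"
      by (simp only: M.act_scale P.P_scale[OF \<nu>] V.scale_scale mult.assoc)
  qed
  show ?thesis
    unfolding solves_on_def has_dir_derivative_def
  proof (rule ballI, rule P.tendsto_iff_P[THEN iffD2], rule ballI)
    fix l \<nu> assume l: "l \<in> U" and \<nu>: "\<nu> \<in> hstar G"
    have lh: "l \<in> hstar G" using l assms(11) by (auto simp: regular_points_def)
    let ?c = "\<lambda>(z::complex) x. l x + z * \<mu> x"
    let ?u = "\<lambda>z. P \<nu> (g (- ?c z))"
    let ?D = "D_op G Y \<iota> T1 \<kappa> \<mu> (- l)"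
    let ?r = "\<lambda>a. pairing G a \<mu> / (exp (pairing G a l) - 1)"
    let ?\<phi> = "\<Sum>a\<in>pos_roots G. ?r a * (?b * \<nu> (hvec G a))"
    have P_D: "P \<nu> (\<rho> ?D v) = \<rho> ?D (P \<nu> v)" for v
      by (intro P_\<rho> \<nu> \<iota>_cartan_commute_D_op \<mu>)
    have "((\<lambda>z. \<Sum>a\<in>pos_roots G. L a (?c z) * (?b * \<nu> (hvec G a))) has_field_derivative ?\<phi>) (at 0)"
      by (intro DERIV_sum DERIV_cmult_right
          has_field_derivative_log_branch_line[OF assms(10,11) l \<mu> _ assms(12)])
    from DERIV_chain2[OF DERIV_exp this]
    have e: "((\<lambda>z. E \<nu> (?c z)) has_field_derivative ?\<phi> * E \<nu> l) (at 0)"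
      by (simp add: E_def mult.commute)
    have "((\<lambda>z. vs (1 / z) (g (\<lambda>x. (- l) x + z * \<mu> x) - g (- l))) \<longlongrightarrow> \<rho> ?D (g (- l))) (at 0)"
      using assms(13) l unfolding solves_on_def has_dir_derivative_def by blast
    then have "((\<lambda>z. P \<nu> (vs (1 / z) (g (\<lambda>x. (- l) x + z * \<mu> x) - g (- l))))
        \<longlongrightarrow> P \<nu> (\<rho> ?D (g (- l)))) (at 0)"
      using \<nu> by (rule P.tendsto_iff_P[THEN iffD1, rule_format])
    \<comment> \<open>Replacing \<open>z\<close> by \<open>- z\<close> turns the quotient of
      \<open>g\<close> at \<open>- l\<close> into that of \<open>g (- ?c z)\<close> and negates the
      limit.\<close>
    moreover have "filterlim uminus (at 0) (at (0::complex))"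
      by (simp add: filterlim_def filtermap_at_minus)
    ultimately have "((\<lambda>z. P \<nu> (vs (1 / - z) (g (\<lambda>x. (- l) x + - z * \<mu> x) - g (- l))))
        \<longlongrightarrow> P \<nu> (\<rho> ?D (g (- l)))) (at 0)"
      by (rule filterlim_compose)
    then have "((\<lambda>z. - vs (1 / - z) (P \<nu> (g (\<lambda>x. (- l) x + - z * \<mu> x)) - P \<nu> (g (- l))))
        \<longlongrightarrow> - \<rho> ?D (P \<nu> (g (- l)))) (at 0)"
      unfolding P_D P.P_scale[OF \<nu>] P.P_diff[OF \<nu>] by (rule tendsto_minus)
    then have u: "((\<lambda>z. vs (1 / z) (?u z - ?u 0)) \<longlongrightarrow> - \<rho> ?D (?u 0)) (at 0)"
      by (simp add: fun_Compl_def)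
    \<comment> \<open>The right-hand side is the limit supplied by the product rule, with
      \<open>E \<nu>\<close> as scalar factor and \<open>?u\<close> as vector factor.\<close>
    have eq: "P \<nu> (\<rho> (trig_casimir G Y \<iota> T1 (- 2 * \<kappa>) \<mu> l) (?gt l))
        = vs (E \<nu> (?c 0)) (- \<rho> ?D (?u 0)) + vs (?\<phi> * E \<nu> l) (?u 0)"
    proof -
      let ?A = "\<Sum>a\<in>pos_roots G. yscale Y (?b * ?r a) (\<iota> (hvec G a))"
      let ?w = "P \<nu> (?gt l)"
      have A: "trig_casimir G Y \<iota> T1 (- 2 * \<kappa>) \<mu> l = ?A - ?D"
        by (rule trig_casimir_eq_D_op[OF lh \<mu>])
      have "\<iota> t * ?A = ?A * \<iota> t" if "t \<in> cartan G" for t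
        using that by (intro commute_sum commute_scale \<iota>_cartan_commute hvec_cartan pos_root_hstar)
      then have "\<iota> t * (?A - ?D) = (?A - ?D) * \<iota> t" if "t \<in> cartan G" for t
        using \<iota>_cartan_commute_D_op[OF that \<mu>] that by (simp only: left_diff_distrib right_diff_distrib)
      then have "P \<nu> (\<rho> (?A - ?D) (?gt l)) = \<rho> (?A - ?D) ?w"
        by (rule P_\<rho>[OF \<nu>])
      also have "\<dots> = \<rho> ?A ?w - \<rho> ?D ?w"
        using M.act_add[of "?A - ?D" ?D ?w] by (simp add: algebra_simps)
      also have "\<rho> ?A ?w = (\<Sum>a\<in>pos_roots G. vs (?b * ?r a) (\<rho> (\<iota> (hvec G a)) ?w))"
        by (simp only: act_sum M.act_scale)
      \<comment> \<open>On weight \<open>\<nu>\<close> each \<open>hvec G a\<close> acts by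
        \<open>\<nu> (hvec G a)\<close>, so \<open>?A\<close> becomes the logarithmic derivative of
        the gauge scalar.\<close>
      also have "\<dots> = vs ?\<phi> ?w"
        by (simp add: P_\<iota> \<nu> V.scale_sum_left mult_ac cong: sum.cong)
      finally show ?thesis
        unfolding A by (simp add: P_gt[OF \<nu>] VV.linear_scale[OF M.linear] fun_Compl_def)
    qed
    show "((\<lambda>z. P \<nu> (vs (1 / z) (?gt (?c z) - ?gt l)))
        \<longlongrightarrow> P \<nu> (\<rho> (trig_casimir G Y \<iota> T1 (- 2 * \<kappa>) \<mu> l) (?gt l))) (at 0)"
      using V.tendsto_difference_quotient_scale[OF e u]
      unfolding eq P.P_scale[OF \<nu>] P.P_diff[OF \<nu>] P_gt[OF \<nu>] by simp
  qed
qed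

end
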